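(* Let $G=(V,E)$ be a digraph such that there exists a positive integer $N$ satisfying $\Omega_n(G)=0$ for every integer $n\ge N+1$. Let $f,g,h:V\to\mathbb{R}\setminus\{0\}$ be three non-vanishing real functions on $V$, and let $T(G,f,g)$ denote the $(f,g)$-weighted analytic torsion of $G$. Then: (i) $T(G,fh,gh)=T(G,f,g)$; (ii) for every non-zero real constant $c$, $T(G,f,cg)=t(G,c)\,T(G,f,g)$ and $T(G,cf,g)=t(G,c)^{-1}\,T(G,f,g)$, where $t(G,c)=|c|^{s(G)}$ and $s(G)=\sum_{n\ge 0}(-1)^n\dim \partial_n\Omega_n(G)$.
   Context: A digraph $G=(V,E)$ consists of a finite set $V$ and a subset $E\subseteq\{(u,v)\in V\times V: u\ne v\}$. Paths. For $n\ge 0$, an elementary $n$-path on $V$ is a sequence $v_0v_1\ldots v_n$ of elements of $V$ (repetitions allowed); $\Lambda_n(V)$ is the real vector space with basis the elementary $n$-paths, and $\Lambda_{-1}(V)=0$. An elementary path is regular if $v_{i-1}\ne v_i$ for all $1\le i\le n$, irregular otherwise; $I_n(V)\subseteq\Lambda_n(V)$ is the span of the irregular elementary $n$-paths and $\mathcal{R}_n(V)=\Lambda_n(V)/I_n(V)$, which has as basis the (classes of) regular elementary $n$-paths; $\mathcal R_{-1}(V)=0$. Weighted boundary. For $f:V\to\mathbb{R}\setminus\{0\}$, let $\partial_n^f:\Lambda_n(V)\to\Lambda_{n-1}(V)$ be the linear map with $\partial^f_n(v_0\ldots v_n)=\sum_{i=0}^n(-1)^i f(v_i)\,v_0\ldots\widehat{v_i}\ldots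 v_n$ for $n\ge1$, and $\partial_0^f=0$. It induces $\partial_n^f:\mathcal{R}_n(V)\to\mathcal{R}_{n-1}(V)$ with $\partial^f_{n}\partial^f_{n+1}=0$. Write $\partial_n=\partial_n^1$ for the constant weight $1$. Weighted inner product. For $g:V\to\mathbb{R}\setminus\{0\}$, $\langle\,,\rangle_g$ is the bilinear inner product on $\mathcal{R}_n(V)$ given on regular elementary paths by $\langle v_0\ldots v_n,u_0\ldots u_n\rangle_g=\prod_{i=0}^n g(v_i)g(u_i)\delta(v_i,u_i)$, where $\delta(v,u)=1$ if $v=u$ and $0$ otherwise. Weighted path complex. $\mathcal{A}_n(G)\subseteq\mathcal{R}_n(V)$ is the span of the elementary $n$-paths $v_0\ldots v_n$ with $(v_{i-1},v_i)\in E$ for all $1\le i\le n$ (and $\mathcal A_{-1}(G)=0$). Put $\Omega_n^{f,g}(G)=\mathcal{A}_n(G)\cap(\partial_n^f)^{-1}(\mathcal{A}_{n-1}(G))$, a chain complex with boundary $\partial^f_n$, endowed with the restriction of the inner product $\langle\,,\rangle_g$. The unweighted complex is $\Omega_n(G)=\mathcal{A}_n(G)\cap\partial_n^{-1}(\mathcal{A}_{n-1}(G))$ with boundary $\partial_n$. Weighted Laplacian and torsion. Let $\Delta_n^{f,g}(G)=(\partial_n^f|_{\Omega_n^{f,g}(G)})^*(\partial_n^f|_{\Omega_n^{f,g}(G)})+(\partial_{n+1}^f|_{\Omega_{n+1}^{f,g}(G)})(\partial_{n+1}^f|_{\Omega_{n+1}^{f,g}(G)})^*$ on $\Omega_n^{f,g}(G)$,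 where $*$ denotes the adjoint of a map $\Omega_k^{f,g}(G)\to\Omega_{k-1}^{f,g}(G)$ with respect to $\langle\,,\rangle_g$. With $\lambda_i$ the eigenvalues of $\Delta_n^{f,g}(G)$ counted with multiplicity, set $\zeta_n^{f,g}(s)=\sum_{\lambda_i>0}\lambda_i^{-s}$. If $\Omega_n(G)=0$ for all $n\ge N+1$ (equivalently $\Omega^{f,g}_n(G)=0$ for all $n\ge N+1$), $T(G,f,g)>0$ is defined by $\log T(G,f,g)=\frac12\sum_{n=0}^N(-1)^n n\,\frac{d}{ds}\big|_{s=0}\zeta_n^{f,g}(s)$. Products $fh$, $gh$, $cf$, $cg$ are pointwise. *)

theory Defs
  imports "HOL-Analysis.Analysis" "HOL-Analysis.Finite_Function_Topology" "Graph_Theory.Pair_Digraph"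
begin

text \<open>
  An elementary \<open>n\<close>-path is a list of length \<open>n + 1\<close>, and the elements of \<open>\<Lambda>\<^sub>n(V)\<close> are
  finitely supported real functions on lists.  The quotient \<open>R\<^sub>n(V) = \<Lambda>\<^sub>n(V) / I\<^sub>n(V)\<close> is represented
  through its basis of regular paths: a class is identified with its unique representative supported on
  regular paths (\<open>distinct_adj\<close>), and \<open>regular_part\<close> is the quotient map.  The only degree \<open>-1\<close> objects,
  \<open>\<Lambda>\<^sub>-\<^sub>1 = R\<^sub>-\<^sub>1 = A\<^sub>-\<^sub>1 = 0\<close>, enter through the convention that the boundary in degree 0 vanishes.
\<close>

type_synonym 'a chain = "'a list \<Rightarrow>\<^sub>0 real"

definition regular_part :: "'a chain \<Rightarrow> 'a chain" where
  "regular_part x =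
     (\<Sum>p\<in>{p \<in> Poly_Mapping.keys x. distinct_adj p}. Poly_Mapping.single p (Poly_Mapping.lookup x p))"

definition delete_vertex :: "nat \<Rightarrow> 'a list \<Rightarrow> 'a list" where
  "delete_vertex i p = take i p @ drop (Suc i) p"

definition path_boundary :: "('a \<Rightarrow> real) \<Rightarrow> nat \<Rightarrow> 'a list \<Rightarrow> 'a chain" where
  "path_boundary f n p =
     (if n = 0 then 0
      else (\<Sum>i=0..n. ((-1) ^ i * f (p ! i)) *\<^sub>R Poly_Mapping.single (delete_vertex i p) 1))"

text \<open>The boundary on \<open>\<Lambda>\<^sub>n\<close> and the map it induces on \<open>R\<^sub>n\<close>.\<close>

definition free_boundary :: "('a \<Rightarrow> real) \<Rightarrow> nat \<Rightarrow> 'a chain \<Rightarrow> 'a chain" where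
  "free_boundary f n x =
     (\<Sum>p\<in>Poly_Mapping.keys x. Poly_Mapping.lookup x p *\<^sub>R path_boundary f n p)"

definition boundary :: "('a \<Rightarrow> real) \<Rightarrow> nat \<Rightarrow> 'a chain \<Rightarrow> 'a chain" where
  "boundary f n x = regular_part (free_boundary f n x)"

text \<open>Only chains of one and the same degree are ever paired, so \<open>p\<close> and \<open>q\<close> have equal length.\<close>

definition path_inner :: "('a \<Rightarrow> real) \<Rightarrow> 'a list \<Rightarrow> 'a list \<Rightarrow> real" where
  "path_inner g p q =
     (\<Prod>i<length p. g (p ! i) * g (q ! i) * (if p ! i = q ! i then 1 else 0))"

definition chain_inner :: "('a \<Rightarrow> real) \<Rightarrow> 'a chain \<Rightarrow> 'a chain \<Rightarrow> real" where
  "chain_inner g x y =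
     (\<Sum>p\<in>Poly_Mapping.keys x. \<Sum>q\<in>Poly_Mapping.keys y.
        Poly_Mapping.lookup x p * Poly_Mapping.lookup y q * path_inner g p q)"

definition allowed_paths :: "'a pair_pre_digraph \<Rightarrow> nat \<Rightarrow> 'a list set" where
  "allowed_paths G n =
     {p. length p = n + 1 \<and> set p \<subseteq> pverts G \<and> successively (\<lambda>u v. (u, v) \<in> parcs G) p}"

definition allowed_chains :: "'a pair_pre_digraph \<Rightarrow> nat \<Rightarrow> 'a chain set" where
  "allowed_chains G n = span ((\<lambda>p. Poly_Mapping.single p 1) ` allowed_paths G n)"

text \<open>
  For \<open>n = 0\<close> the truncated \<open>n - 1\<close> is harmless: the boundary is 0 there, so the second condition is
  void, just as it is for \<open>A\<^sub>-\<^sub>1 = 0\<close>.  As a space this does not depend on \<open>g\<close>; the unweighted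
  complex is \<open>Omega G (\<lambda>_. 1)\<close>.
\<close>

definition Omega :: "'a pair_pre_digraph \<Rightarrow> ('a \<Rightarrow> real) \<Rightarrow> nat \<Rightarrow> 'a chain set" where
  "Omega G f n = {x \<in> allowed_chains G n. boundary f n x \<in> allowed_chains G (n - 1)}"

text \<open>The adjoint \<open>Omega (n - 1) \<rightarrow> Omega n\<close> of \<open>boundary f n : Omega n \<rightarrow> Omega (n - 1)\<close>
  (for \<open>n = 0\<close> it is the zero map).\<close>

definition boundary_adjoint ::
  "'a pair_pre_digraph \<Rightarrow> ('a \<Rightarrow> real) \<Rightarrow> ('a \<Rightarrow> real) \<Rightarrow> nat \<Rightarrow> 'a chain \<Rightarrow> 'a chain" where
  "boundary_adjoint G f g n y =
     (THE x. x \<in> Omega G f n \<and>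
        (\<forall>u\<in>Omega G f n. chain_inner g u x = chain_inner g (boundary f n u) y))"

definition Laplacian ::
  "'a pair_pre_digraph \<Rightarrow> ('a \<Rightarrow> real) \<Rightarrow> ('a \<Rightarrow> real) \<Rightarrow> nat \<Rightarrow> 'a chain \<Rightarrow> 'a chain" where
  "Laplacian G f g n x =
     boundary_adjoint G f g n (boundary f n x)
     + boundary f (n + 1) (boundary_adjoint G f g (n + 1) x)"

definition eigenspace ::
  "'a pair_pre_digraph \<Rightarrow> ('a \<Rightarrow> real) \<Rightarrow> ('a \<Rightarrow> real) \<Rightarrow> nat \<Rightarrow> real \<Rightarrow> 'a chain set" where
  "eigenspace G f g n \<mu> = {x \<in> Omega G f n. Laplacian G f g n x = \<mu> *\<^sub>R x}"

text \<open>The Laplacian is self-adjoint, so the multiplicity of an eigenvalue is the dimension of its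
  eigenspace.\<close>

definition zeta ::
  "'a pair_pre_digraph \<Rightarrow> ('a \<Rightarrow> real) \<Rightarrow> ('a \<Rightarrow> real) \<Rightarrow> nat \<Rightarrow> real \<Rightarrow> real" where
  "zeta G f g n s =
     (\<Sum>\<mu> | \<mu> > 0 \<and> eigenspace G f g n \<mu> \<noteq> {0}.
        real (dim (eigenspace G f g n \<mu>)) * \<mu> powr (- s))"

text \<open>
  The upper summation bound is any \<open>N\<close> beyond which the complex vanishes; for non-vanishing weights
  the choice is immaterial, since \<open>zeta G f g n = 0\<close> whenever \<open>Omega G (\<lambda>_. 1) n = {0}\<close>.
  The least such \<open>N\<close> is taken to make it definite.
\<close>

definition top_degree :: "'a pair_pre_digraph \<Rightarrow> nat" where
  "top_degree G = (LEAST N. \<forall>n\<ge>N + 1. Omega G (\<lambda>_. 1) n = {0})"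

definition torsion :: "'a pair_pre_digraph \<Rightarrow> ('a \<Rightarrow> real) \<Rightarrow> ('a \<Rightarrow> real) \<Rightarrow> real" where
  "torsion G f g =
     exp (1 / 2 * (\<Sum>n=0..top_degree G. (-1) ^ n * real n * deriv (zeta G f g n) 0))"

text \<open>\<open>Sum_any\<close> is the sum over all \<open>n\<close> of a finitely supported family.\<close>

definition torsion_exponent :: "'a pair_pre_digraph \<Rightarrow> int" where
  "torsion_exponent G =
     Sum_any (\<lambda>n::nat. (-1) ^ n * int (dim (boundary (\<lambda>_. 1) n ` Omega G (\<lambda>_. 1) n)))"

definition torsion_factor :: "'a pair_pre_digraph \<Rightarrow> real \<Rightarrow> real" where
  "torsion_factor G c = \<bar>c\<bar> powi torsion_exponent G"

end

theory Submission
  imports Defs "HOL-Computational_Algebra.Fundamental_Theorem_Algebra"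
begin

text \<open>
  Part (i): multiplying every path by the product of the values of \<open>h\<close> on its vertices is an isometric
  isomorphism from the \<open>(fh, gh)\<close>-weighted complex onto the \<open>(f, g)\<close>-weighted one, so the two
  Laplacians have the same eigenvalues.  Part (ii): replacing \<open>g\<close> by \<open>cg\<close> multiplies the inner product
  in degree \<open>n\<close> by \<open>c\<^sup>2\<^sup>(\<^sup>n\<^sup>+\<^sup>1\<^sup>)\<close>, hence the adjoint boundary and the Laplacian by \<open>c\<^sup>-\<^sup>2\<close>; so \<open>\<zeta>\<^sub>n(s)\<close> is multiplied
  by \<open>\<bar>c\<bar>\<^sup>2\<^sup>s\<close>, and its derivative at 0 grows by \<open>2 ln \<bar>c\<bar> \<zeta>\<^sub>n(0)\<close>.  By the spectral theorem and the
  Hodge decomposition \<open>\<zeta>\<^sub>n(0) = rank \<partial>\<^sub>n + rank \<partial>\<^sub>n\<^sub>+\<^sub>1\<close>, and \<open>\<Sum>(-1)\<^sup>n n \<zeta>\<^sub>n(0)\<close> telescopes to the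
  exponent \<open>s(G)\<close>.  The formula for \<open>cf\<close> follows from that for \<open>c\<^sup>-\<^sup>1g\<close> by part (i) with \<open>h = c\<close>.
\<close>

section \<open>Rank and nullity in finite-dimensional subspaces\<close>

lemma finite_basis_subspace:
  fixes S :: "'b::real_vector set"
  assumes "subspace S" "finite F" "S \<subseteq> span F"
  obtains B where "finite B" "independent B" "span B = S" "card B = dim S"
proof -
  obtain B where B: "B \<subseteq> S" "independent B" "S \<subseteq> span B" "card B = dim S"
    using real_vector.basis_exists[of S] by blast
  have "finite B"
    using real_vector.independent_span_bound[OF assms(2) B(2)] B(1) assms(3) by blast
  moreover have "span B = S"
    using B assms(1) by (simp add: span_minimal subset_antisym)
  ultimately show thesis using that B by blast
qed

lemma dim_injective_image:
  fixes \<phi> :: "'b::real_vector \<Rightarrow> 'c::real_vector"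
  assumes "linear \<phi>" "inj_on \<phi> (span S)"
  shows "dim (\<phi> ` S) = dim S"
proof -
  obtain B where B: "B \<subseteq> S" "independent B" "S \<subseteq> span B" "card B = dim S"
    using real_vector.basis_exists[of S] by blast
  have sp: "span B = span S"
    using B by (simp add: span_eq span_superset subset_trans[OF B(1)])
  have inj: "inj_on \<phi> (span B)" using assms(2) sp by simp
  have "independent (\<phi> ` B)"
    using linear_independent_injective_image[OF assms(1) B(2) inj] .
  moreover have "span (\<phi> ` B) = span (\<phi> ` S)"
    using sp by (simp add: linear_span_image[OF assms(1)])
  moreover have "card (\<phi> ` B) = card B"
    using inj_on_subset[OF inj span_superset] by (rule card_image)
  ultimately show ?thesis
    using real_vector.dim_eq_card[of "\<phi> ` B" "\<phi> ` S"] B(4) by simp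
qed

text \<open>The type of chains is infinite-dimensional, so finite dimension is expressed throughout
  as containment in the span of a finite \<open>F\<close>. A basis \<open>B\<close> of the kernel
  extends to a basis \<open>C\<close> of \<open>S\<close>, and the added vectors \<open>D\<close>
  map to a basis of the image.\<close>

lemma rank_nullity:
  fixes \<phi> :: "'b::real_vector \<Rightarrow> 'c::real_vector"
  assumes \<phi>: "linear \<phi>" and S: "subspace S" and F: "finite F" "S \<subseteq> span F"
  shows "dim S = dim {x \<in> S. \<phi> x = 0} + dim (\<phi> ` S)"
proof -
  define K where "K = {x \<in> S. \<phi> x = 0}"
  have K: "subspace K"
    using S \<phi> unfolding K_def subspace_def
    by (auto simp: linear_add linear_scale linear_0)
  have KS: "K \<subseteq> S" by (auto simp: K_def)
  obtain B where B: "finite B" "independent B" "span B = K" "card B = dim K"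
    using finite_basis_subspace[OF K F(1)] KS F(2) by auto
  have "B \<subseteq> S" using B(3) KS span_superset by blast
  then obtain C where C: "B \<subseteq> C" "C \<subseteq> S" "independent C" "S \<subseteq> span C"
    using real_vector.maximal_independent_subset_extend[of B S] B(2) by metis
  have "finite C"
    using real_vector.independent_span_bound[OF F(1) C(3)] C(2) F(2) by blast
  have CS: "span C = S" using C S by (simp add: span_minimal subset_antisym)
  have cC: "card C = dim S" using C real_vector.basis_card_eq_dim by blast
  define D where "D = C - B"
  have D: "independent D" using C(3) real_vector.independent_mono[of C D] by (auto simp: D_def)
  have C_eq: "C = B \<union> D" using C(1) by (auto simp: D_def)
  have inj: "inj_on \<phi> (span D)"
  proof (subst linear_inj_on_iff_eq_0[OF \<phi>])
    show "subspace (span D)" by simp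
    show "\<forall>x\<in>span D. \<phi> x = 0 \<longrightarrow> x = 0"
    proof (intro ballI impI)
      fix x assume x: "x \<in> span D" "\<phi> x = 0"
      have "x \<in> S" using x(1) span_mono[of D C] CS by (auto simp: D_def)
      then have "x \<in> span B" using x(2) B(3) by (simp add: K_def)
      \<comment> \<open>A vector in both \<open>span B\<close> and \<open>span D\<close> has its
        coordinates over \<open>C\<close> supported on two disjoint sets, so all of them
        vanish.\<close>
      have "representation C x = representation B x"
        using real_vector.representation_extend[OF C(3) \<open>x \<in> span B\<close> C(1)] .
      moreover have "representation C x = representation D x"
        using real_vector.representation_extend[OF C(3) x(1)] by (simp add: D_def)
      ultimately have "representation C x b = 0" for b
        using real_vector.representation_ne_zero[of B x b] real_vector.representation_ne_zero[of D x b]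
        by (auto simp: D_def)
      then show "x = 0"
        using real_vector.sum_nonzero_representation_eq[OF C(3), of x] C(4) \<open>x \<in> S\<close> by auto
    qed
  qed
  have "span (\<phi> ` D) = \<phi> ` S"
  proof -
    have "\<phi> ` S = span (\<phi> ` B \<union> \<phi> ` D)"
      using linear_span_image[OF \<phi>, of C] CS C_eq by (simp add: image_Un)
    also have "\<dots> = span (\<phi> ` D)"
    proof -
      have "\<phi> ` B \<subseteq> {0}" using B(3) span_superset[of B] by (auto simp: K_def)
      then have "\<phi> ` B \<subseteq> span (\<phi> ` D)" using span_0[of "\<phi> ` D"] by (metis empty_subsetI insert_subset subset_trans)
      then show ?thesis
        unfolding span_eq using span_superset[of "\<phi> ` D"] span_superset[of "\<phi> ` B \<union> \<phi> ` D"] by blast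
    qed
    finally show ?thesis by simp
  qed
  then have "dim (\<phi> ` S) = dim D"
    using dim_injective_image[OF \<phi> inj] real_vector.dim_span[of "\<phi> ` D"] by simp
  also have "\<dots> = card D" using D by (simp add: real_vector.dim_eq_card_independent)
  finally have "dim (\<phi> ` S) = card D" .
  moreover have "card C = card B + card D"
    unfolding D_def using C(1) \<open>finite C\<close> B(1)
    by (metis card_Diff_subset card_mono le_add_diff_inverse)
  ultimately show ?thesis using cC B(4) by (simp add: K_def)
qed

section \<open>Polynomials in an operator\<close>

text \<open>This is p(T) x by Horner's rule, which gives a recursion suited to induction on
  polynomials.\<close>

definition poly_act :: "('b::real_vector \<Rightarrow> 'b) \<Rightarrow> real poly \<Rightarrow> 'b \<Rightarrow> 'b" where
  "poly_act T p x = fold_coeffs (\<lambda>a y. a *\<^sub>R x + T y) p 0"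

lemma poly_act_0 [simp]: "poly_act T 0 x = 0"
  by (simp add: poly_act_def)

context
  fixes T :: "'b::real_vector \<Rightarrow> 'b"
  assumes T: "linear T"
begin

lemma poly_act_pCons [simp]: "poly_act T (pCons a p) x = a *\<^sub>R x + T (poly_act T p x)"
  by (cases "p = 0 \<and> a = 0") (auto simp: poly_act_def linear_0[OF T])

lemma poly_act_add: "poly_act T (p + q) x = poly_act T p x + poly_act T q x"
  by (induction p q rule: poly_induct2)
     (simp_all add: linear_add[OF T] linear_0[OF T] scaleR_add_left)

lemma poly_act_smult: "poly_act T (smult c p) x = c *\<^sub>R poly_act T p x"
  by (induction p) (simp_all add: linear_scale[OF T] linear_0[OF T] scaleR_add_right)

lemma poly_act_mult: "poly_act T (p * q) x = poly_act T p (poly_act T q x)"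
  by (induction p) (simp_all add: poly_act_add poly_act_smult linear_0[OF T])

lemma poly_act_sum: "poly_act T (\<Sum>i\<in>I. p i) x = (\<Sum>i\<in>I. poly_act T (p i) x)"
  by (induction I rule: infinite_finite_induct) (simp_all add: poly_act_add)

lemma poly_act_monom: "poly_act T (monom c i) x = c *\<^sub>R (T ^^ i) x"
  by (induction i) (simp_all add: monom_0 monom_Suc linear_scale[OF T] linear_0[OF T])

lemma poly_act_mem:
  assumes "subspace S" "\<And>x. x \<in> S \<Longrightarrow> T x \<in> S" "x \<in> S"
  shows "poly_act T p x \<in> S"
  using assms by (induction p) (simp_all add: subspace_0 subspace_add subspace_scale)

text \<open>Infinitely many vectors of a finite-dimensional space are dependent, and a dependence
  among the iterates of \<open>T\<close> on \<open>x\<close> is an annihilating polynomial.\<close>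

lemma annihilating_poly_exists:
  assumes S: "subspace S" "finite F" "S \<subseteq> span F"
    and inv: "\<And>x. x \<in> S \<Longrightarrow> T x \<in> S" and x: "x \<in> S"
  obtains p where "p \<noteq> 0" "poly_act T p x = 0"
\<comment> \<open>Dependence concerns sets and overlooks repeated iterates, so a repetition is
  treated separately and yields t^i - t^j.\<close>
proof (cases "inj (\<lambda>i. (T ^^ i) x)")
  case False
  then obtain i j where "i \<noteq> j" "(T ^^ i) x = (T ^^ j) x"
    by (auto simp: inj_def)
  then have "poly_act T (monom 1 i + monom (-1) j) x = 0"
    by (simp only: poly_act_add poly_act_monom) simp
  moreover have "coeff (monom (1::real) i + monom (-1) j) i \<noteq> 0"
    using \<open>i \<noteq> j\<close> by simp
  then have "monom (1::real) i + monom (-1) j \<noteq> 0" by (metis coeff_0)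
  ultimately show thesis using that by blast
next
  case True
  define R where "R = range (\<lambda>i. (T ^^ i) x)"
  have "(T ^^ i) x \<in> S" for i
    by (induction i) (use inv x in auto)
  then have "R \<subseteq> span F" using S(3) by (auto simp: R_def)
  moreover have "infinite R" using True by (simp add: R_def finite_image_iff)
  ultimately have "dependent R"
    using real_vector.independent_span_bound[OF S(2)] by blast
  then obtain t u where t: "finite t" "t \<subseteq> R" "(\<Sum>v\<in>t. u v *\<^sub>R v) = 0" "\<exists>v\<in>t. u v \<noteq> 0"
    unfolding real_vector.dependent_explicit by blast
  define I where "I = {i. (T ^^ i) x \<in> t}"
  have fI: "finite I" unfolding I_def
    using finite_vimageI[OF t(1) True] by (simp add: vimage_def)
  have im: "(\<lambda>i. (T ^^ i) x) ` I = t" using t(2) by (auto simp: I_def R_def)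
  define p where "p = (\<Sum>i\<in>I. monom (u ((T ^^ i) x)) i)"
  have "poly_act T p x = (\<Sum>i\<in>I. u ((T ^^ i) x) *\<^sub>R (T ^^ i) x)"
    by (simp add: p_def poly_act_sum poly_act_monom)
  also have "\<dots> = (\<Sum>v\<in>(\<lambda>i. (T ^^ i) x) ` I. u v *\<^sub>R v)"
    by (subst sum.reindex) (auto intro: inj_on_subset[OF True])
  also have "\<dots> = 0" using im t(3) by simp
  finally have "poly_act T p x = 0" .
  moreover obtain i where i: "i \<in> I" "u ((T ^^ i) x) \<noteq> 0"
    using t(4) unfolding im[symmetric] by blast
  have "coeff p i \<noteq> 0"
    using i fI by (simp add: p_def coeff_sum)
  then have "p \<noteq> 0" by (metis coeff_0)
  ultimately show thesis using that by blast
qed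

end

section \<open>Factorisation of real polynomials\<close>

lemma poly_map_of_real_add:
  "poly (map_poly complex_of_real (p + q)) z =
    poly (map_poly complex_of_real p) z + poly (map_poly complex_of_real q) z"
  by (induction p q rule: poly_induct2) (simp_all add: map_poly_pCons algebra_simps)

lemma poly_map_of_real_mult:
  "poly (map_poly complex_of_real (p * q)) z =
    poly (map_poly complex_of_real p) z * poly (map_poly complex_of_real q) z"
proof (induction p)
  case (pCons a p)
  have "poly (map_poly complex_of_real (smult a q)) z = of_real a * poly (map_poly complex_of_real q) z"
    by (induction q) (simp_all add: map_poly_pCons algebra_simps)
  then show ?case
    using pCons by (simp add: poly_map_of_real_add map_poly_pCons algebra_simps)
qed simp

text \<open>A complex root \<open>z\<close> yields the factor: linear if \<open>z\<close> is real,
  otherwise the quadratic whose roots are \<open>z\<close> and its conjugate.\<close>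

lemma real_poly_linear_or_quadratic_factor:
  fixes p :: "real poly"
  assumes "degree p > 0"
  obtains a q where "p = [:- a, 1:] * q"
  | a b q where "b \<noteq> 0" "p = ([:- a, 1:]\<^sup>2 + [:b\<^sup>2:]) * q"
proof -
  have "\<not> constant (poly (map_poly complex_of_real p))"
    using assms by (simp add: constant_degree degree_map_poly)
  then obtain z where z: "poly (map_poly complex_of_real p) z = 0"
    using fundamental_theorem_of_algebra by blast
  show thesis
  proof (cases "Im z = 0")
    case True
    then have "z = of_real (Re z)" by (simp add: complex_eq_iff)
    then have "poly p (Re z) = 0"
    proof -
      have "poly (map_poly complex_of_real p) (of_real t) = of_real (poly p t)" for t
        by (induction p) (simp_all add: map_poly_pCons)
      then show ?thesis using z \<open>z = of_real (Re z)\<close> by (metis of_real_eq_0_iff)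
    qed
    then show thesis using that(1) by (auto simp: poly_eq_0_iff_dvd elim: dvdE)
  next
    case False
    define d where "d = [:- Re z, 1:]\<^sup>2 + [:(Im z)\<^sup>2:]"
    have d_eq: "d = [:(Re z)\<^sup>2 + (Im z)\<^sup>2, - 2 * Re z, 1:]"
      by (simp add: d_def power2_eq_square)
    have dz: "poly (map_poly complex_of_real d) z = 0"
      by (simp add: d_eq map_poly_pCons complex_eq_iff power2_eq_square algebra_simps)
    \<comment> \<open>A real polynomial of degree below 2 that vanishes at a non-real point is 0,
      hence so is this remainder.\<close>
    define r where "r = p mod d"
    have "degree r < 2"
      using degree_mod_less[of d p] by (auto simp: r_def d_eq)
    then have "r = [:coeff r 0, coeff r 1:]"
      by (auto intro!: poly_eqI simp: coeff_pCons coeff_eq_0 split: nat.split)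
    then obtain s t where r: "r = [:s, t:]" by blast
    have "poly (map_poly complex_of_real p) z =
        poly (map_poly complex_of_real (p div d)) z * poly (map_poly complex_of_real d) z
        + poly (map_poly complex_of_real r) z"
      unfolding r_def poly_map_of_real_mult[symmetric] poly_map_of_real_add[symmetric] by simp
    then have "poly (map_poly complex_of_real r) z = 0"
      using z dz by simp
    then have "t * Im z = 0" "s + t * Re z = 0"
      by (auto simp: r complex_eq_iff map_poly_pCons mult.commute)
    then have "r = 0" using False by (simp add: r)
    then have "d dvd p" by (simp add: r_def dvd_eq_mod_eq_0)
    then show thesis using that(2)[OF False] unfolding d_def by (auto elim: dvdE)
  qed
qed

section \<open>Inner products and self-adjoint operators\<close>

lemma dim_zero_subspace: "dim {0 :: 'b::real_vector} = 0"
  using real_vector.dim_eq_card[of "{}" "{0 :: 'b}"] real_vector.independent_empty by simp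

text \<open>The form is a parameter rather than a type class operation because the inner product on
  chains varies with the weight \<open>g\<close>.\<close>

locale inner_form =
  fixes ip :: "'b::real_vector \<Rightarrow> 'b \<Rightarrow> real"
  assumes ip_commute: "ip x y = ip y x"
    and ip_add_left: "ip (x + y) z = ip x z + ip y z"
    and ip_scale_left: "ip (c *\<^sub>R x) y = c * ip x y"
    and ip_pos: "x \<noteq> 0 \<Longrightarrow> ip x x > 0"
begin

lemma ip_add_right: "ip z (x + y) = ip z x + ip z y"
  by (metis ip_commute ip_add_left)

lemma ip_scale_right: "ip y (c *\<^sub>R x) = c * ip y x"
  by (metis ip_commute ip_scale_left)

lemma ip_zero [simp]: "ip 0 y = 0" "ip y 0 = 0"
  using ip_scale_left[of 0 0 y] ip_scale_right[of y 0 0] by simp_all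

lemma ip_diff_left: "ip (x - y) z = ip x z - ip y z"
  using ip_add_left[of x "(-1) *\<^sub>R y" z] ip_scale_left[of "-1" y z] by simp

lemma ip_diff_right: "ip z (x - y) = ip z x - ip z y"
  by (metis ip_commute ip_diff_left)

lemmas ip_simps = ip_add_left ip_add_right ip_scale_left ip_scale_right ip_diff_left ip_diff_right

lemma ip_self_nonneg: "ip x x \<ge> 0"
  by (cases "x = 0") (auto intro: less_imp_le ip_pos)

lemma ip_self_eq_0_iff: "ip x x = 0 \<longleftrightarrow> x = 0"
  using ip_pos[of x] by (cases "x = 0") auto

lemma linear_ip_left: "linear (\<lambda>u. ip u y)"
  by (rule linearI) (simp_all add: ip_simps)

lemma eq_if_ip_eq:
  assumes "subspace S" "x \<in> S" "y \<in> S" "\<And>u. u \<in> S \<Longrightarrow> ip u x = ip u y"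
  shows "x = y"
proof -
  have "x - y \<in> S" using assms by (simp add: subspace_diff)
  then have "ip (x - y) (x - y) = 0"
    using assms(4)[of "x - y"] by (simp add: ip_diff_right)
  then show ?thesis by (simp add: ip_self_eq_0_iff)
qed

text \<open>
  Induction on the spanning set, as in Gram-Schmidt: the representer of \<open>u \<mapsto> \<langle>u, b\<rangle>\<close> on the smaller
  span is the projection \<open>s\<close> of the new vector \<open>b\<close>.  If \<open>e = b - s\<close> is 0, the correction term vanishes.
\<close>

lemma riesz_span:
  assumes "finite B" "linear \<phi>"
  shows "\<exists>x\<in>span B. \<forall>u\<in>span B. ip u x = \<phi> u"
  using assms
proof (induction B arbitrary: \<phi> rule: finite_induct)
  case empty
  then show ?case by (simp add: linear_0)
next
  case (insert b B)
  obtain s where s: "s \<in> span B" "\<And>u. u \<in> span B \<Longrightarrow> ip u s = ip u b"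
    using insert.IH[OF linear_ip_left[of b]] by blast
  obtain x where x: "x \<in> span B" "\<And>u. u \<in> span B \<Longrightarrow> ip u x = \<phi> u"
    using insert.IH[OF insert.prems] by blast
  define e where "e = b - s"
  have orth: "ip u e = 0" "ip e u = 0" if "u \<in> span B" for u
    using s(2)[OF that] ip_commute by (simp_all add: e_def ip_simps)
  have B_sub: "span B \<subseteq> span (insert b B)" by (rule span_mono) blast
  have e_mem: "e \<in> span (insert b B)"
    using s(1) B_sub by (auto simp: e_def intro: span_diff span_base)
  define y where "y = x + (\<phi> e / ip e e) *\<^sub>R e"
  have "y \<in> span (insert b B)"
    using x(1) B_sub e_mem by (auto simp: y_def intro: span_add span_scale)
  moreover have "ip u y = \<phi> u" if u_mem: "u \<in> span (insert b B)" for u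
  proof -
    obtain k where k: "u - k *\<^sub>R b \<in> span B"
      using u_mem real_vector.span_breakdown_eq[of u b B] by blast
    define v where "v = u - k *\<^sub>R e"
    have "v = (u - k *\<^sub>R b) + k *\<^sub>R s" by (simp add: v_def e_def algebra_simps)
    then have v: "v \<in> span B" using k s(1) by (simp add: span_add span_scale)
    have u: "u = v + k *\<^sub>R e" by (simp add: v_def)
    have "ip e y = \<phi> e"
      using orth(2)[OF x(1)] linear_0[OF insert.prems]
      by (cases "e = 0") (simp_all add: y_def ip_simps ip_self_eq_0_iff)
    moreover have "ip v y = \<phi> v"
      using x(2)[OF v] orth(1)[OF v] by (simp add: y_def ip_simps)
    ultimately show ?thesis
      using insert.prems by (simp add: u ip_simps linear_add linear_scale)
  qed
  ultimately show ?case by blast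
qed

text \<open>The adjoint of the restriction of \<open>D\<close> to \<open>S\<close>. The codomain
  enters only through the argument \<open>y\<close>, which may be any vector.\<close>

definition adj :: "'b set \<Rightarrow> ('b \<Rightarrow> 'b) \<Rightarrow> 'b \<Rightarrow> 'b" where
  "adj S D y = (THE x. x \<in> S \<and> (\<forall>u\<in>S. ip u x = ip (D u) y))"

lemma adj_eqI:
  assumes "subspace S" "x \<in> S" "\<And>u. u \<in> S \<Longrightarrow> ip u x = ip (D u) y"
  shows "adj S D y = x"
  unfolding adj_def
proof (rule the_equality)
  show "x \<in> S \<and> (\<forall>u\<in>S. ip u x = ip (D u) y)" using assms by blast
next
  fix z assume z: "z \<in> S \<and> (\<forall>u\<in>S. ip u z = ip (D u) y)"
  show "z = x" by (rule eq_if_ip_eq[OF assms(1)]) (use z assms in auto)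
qed

context
  fixes S F :: "'b set"
  assumes S: "subspace S" and F: "finite F" "S \<subseteq> span F"
begin

lemma adj_mem_ip:
  assumes "linear D"
  shows "adj S D y \<in> S" "u \<in> S \<Longrightarrow> ip u (adj S D y) = ip (D u) y"
proof -
  obtain B where B: "finite B" "span B = S"
    using finite_basis_subspace[OF S F] by metis
  have "linear (\<lambda>u. ip (D u) y)"
    using linear_compose[OF assms linear_ip_left[of y]] by (simp add: o_def)
  then obtain x where "x \<in> S" "\<And>u. u \<in> S \<Longrightarrow> ip u x = ip (D u) y"
    using riesz_span[OF B(1)] B(2) by blast
  moreover from this have "adj S D y = x" using adj_eqI[OF S] by blast
  ultimately show "adj S D y \<in> S" "u \<in> S \<Longrightarrow> ip u (adj S D y) = ip (D u) y"
    by auto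
qed

lemma linear_adj:
  assumes "linear D"
  shows "linear (adj S D)"
proof (rule linearI)
  show "adj S D (x + y) = adj S D x + adj S D y" for x y
    by (rule adj_eqI[OF S]) (simp_all add: S subspace_add adj_mem_ip[OF assms] ip_simps)
  show "adj S D (c *\<^sub>R x) = c *\<^sub>R adj S D x" for c x
    by (rule adj_eqI[OF S]) (simp_all add: S subspace_scale adj_mem_ip[OF assms] ip_simps)
qed

text \<open>The adjoint of the inclusion of \<open>E\<close> is the orthogonal projection onto
  \<open>E\<close>; rank-nullity for it on \<open>S\<close> gives the count.\<close>

lemma dim_orthogonal_complement:
  assumes E: "subspace E" "E \<subseteq> S"
  shows "dim S = dim E + dim {x \<in> S. \<forall>e\<in>E. ip e x = 0}"
proof -
  have id: "linear (\<lambda>x::'b. x)" by (rule linearI) auto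
  have FE: "E \<subseteq> span F" using E(2) F(2) by blast
  note P = inner_form.adj_mem_ip[OF inner_form_axioms E(1) F(1) FE id]
  let ?P = "adj E (\<lambda>x. x)"
  have "?P x = 0 \<longleftrightarrow> (\<forall>e\<in>E. ip e x = 0)" for x
    using P(1)[of x] P(2)[of _ x] adj_eqI[OF E(1), of 0 "\<lambda>x. x" x] subspace_0[OF E(1)] by auto
  moreover have "?P e = e" if "e \<in> E" for e
    by (rule adj_eqI[OF E(1) that]) simp
  then have "?P ` S = E"
    using P(1) E(2) by (force simp: image_iff)
  ultimately show ?thesis
    using rank_nullity[OF inner_form.linear_adj[OF inner_form_axioms E(1) F(1) FE id] S F] by simp
qed

end

section \<open>Spectral theorem for self-adjoint operators\<close>

context
  fixes T :: "'b \<Rightarrow> 'b" and F :: "'b set"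
  assumes T: "linear T" and finF: "finite F"
begin

text \<open>
  A real polynomial of least degree annihilating some nonzero vector of \<open>S\<close> must have a linear factor:
  a factor \<open>(t - a)\<^sup>2 + b\<^sup>2\<close> with \<open>b \<noteq> 0\<close> acts injectively, since \<open>T\<close> is self-adjoint.
\<close>

lemma self_adjoint_eigenvector_exists:
  assumes S: "subspace S" "S \<subseteq> span F" "S \<noteq> {0}"
    and inv: "\<And>x. x \<in> S \<Longrightarrow> T x \<in> S"
    and sa: "\<And>x y. x \<in> S \<Longrightarrow> y \<in> S \<Longrightarrow> ip (T x) y = ip x (T y)"
  obtains x \<mu> where "x \<in> S" "x \<noteq> 0" "T x = \<mu> *\<^sub>R x"
proof -
  define Q where "Q k \<longleftrightarrow> (\<exists>p x. p \<noteq> 0 \<and> degree p = k \<and> x \<in> S \<and> x \<noteq> 0 \<and> poly_act T p x = 0)" for k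
  obtain x0 where "x0 \<in> S" "x0 \<noteq> 0" using S(3) subspace_0[OF S(1)] by blast
  moreover obtain p0 where "p0 \<noteq> 0" "poly_act T p0 x0 = 0"
    using annihilating_poly_exists[OF T S(1) finF S(2) inv \<open>x0 \<in> S\<close>] by blast
  ultimately have "\<exists>k. Q k" unfolding Q_def by blast
  define k where "k = (LEAST k. Q k)"
  have "Q k" using \<open>\<exists>k. Q k\<close> unfolding k_def by (metis LeastI_ex)
  then obtain p x where p: "p \<noteq> 0" "degree p = k" "x \<in> S" "x \<noteq> 0" "poly_act T p x = 0"
    unfolding Q_def by blast
  have minimal: "poly_act T q x \<noteq> 0" if "q \<noteq> 0" "degree q < k" for q
    using that p(3,4) not_less_Least[of "degree q" Q] unfolding k_def Q_def by blast
  have "degree p > 0"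
  proof (rule ccontr)
    assume "\<not> degree p > 0"
    then obtain a where "p = [:a:]" by (meson degree_eq_zeroE gr0I)
    then show False using p T by (auto simp: linear_0)
  qed
  have lin: "poly_act T [:- a, 1:] w = T w - a *\<^sub>R w" for a w
    by (simp add: poly_act_pCons[OF T] linear_0[OF T])
  show thesis
    using \<open>degree p > 0\<close>
  proof (cases rule: real_poly_linear_or_quadratic_factor)
    case (1 a q)
    have "q \<noteq> 0" using 1 p(1) by auto
    have "degree p = degree [:- a, 1:] + degree q"
      unfolding 1 by (rule degree_mult_eq) (use \<open>q \<noteq> 0\<close> in auto)
    then have "degree q < k" using p(2) by simp
    define y where "y = poly_act T q x"
    have "y \<noteq> 0" using minimal[OF \<open>q \<noteq> 0\<close> \<open>degree q < k\<close>] by (simp add: y_def)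
    moreover have "y \<in> S" unfolding y_def by (rule poly_act_mem[OF T S(1) inv p(3)])
    moreover have "T y = a *\<^sub>R y"
      using p(5) unfolding 1 poly_act_mult[OF T] y_def[symmetric] lin by simp
    ultimately show thesis using that by blast
  next
    case (2 a b q)
    have "q \<noteq> 0" using 2 p(1) by auto
    have quadratic: "[:- a, 1:]\<^sup>2 + [:b\<^sup>2:] = [:a\<^sup>2 + b\<^sup>2, - 2 * a, 1:]"
      by (simp add: power2_eq_square)
    have "degree p = degree [:a\<^sup>2 + b\<^sup>2, - 2 * a, 1:] + degree q"
      unfolding 2 quadratic by (rule degree_mult_eq) (use \<open>q \<noteq> 0\<close> in auto)
    then have "degree q < k" using p(2) by simp
    define y where "y = poly_act T q x"
    have y: "y \<in> S" "y \<noteq> 0"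
      using minimal[OF \<open>q \<noteq> 0\<close> \<open>degree q < k\<close>] poly_act_mem[OF T S(1) inv p(3)]
      by (simp_all add: y_def)
    define z where "z = T y - a *\<^sub>R y"
    have z: "z \<in> S" using y(1) inv S(1) by (simp add: z_def subspace_diff subspace_scale)
    have "T z - a *\<^sub>R z + b\<^sup>2 *\<^sub>R y = 0"
      using p(5) unfolding 2(2) poly_act_mult[OF T] poly_act_add[OF T] power2_eq_square[of "[:- a, 1:]"]
        y_def[symmetric] lin z_def[symmetric]
      by (simp add: poly_act_pCons[OF T] linear_0[OF T])
    \<comment> \<open>Since z = (T - a) y, moving T - a across the form turns the pairing of this
      relation with \<open>y\<close> into |z|^2 + b^2 |y|^2, which is positive.\<close>
    then have "0 = ip (T z - a *\<^sub>R z + b\<^sup>2 *\<^sub>R y) y" by simp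
    also have "\<dots> = ip z z + b\<^sup>2 * ip y y"
      using sa[OF z y(1)] by (simp add: ip_simps z_def)
    finally have "ip z z + b\<^sup>2 * ip y y = 0" by simp
    moreover have "b\<^sup>2 * ip y y > 0" using 2(1) ip_pos[OF y(2)] by simp
    ultimately show thesis using ip_self_nonneg[of z] by linarith
  qed
qed

text \<open>Induction on the dimension, splitting off one whole eigenspace \<open>E\<close>: its
  orthogonal complement \<open>S'\<close> is invariant, keeps every other eigenspace and loses the
  eigenvalue of \<open>E\<close>.\<close>

lemma sum_dim_eigenspaces:
  assumes S: "subspace S" "S \<subseteq> span F"
    and inv: "\<And>x. x \<in> S \<Longrightarrow> T x \<in> S"
    and sa: "\<And>x y. x \<in> S \<Longrightarrow> y \<in> S \<Longrightarrow> ip (T x) y = ip x (T y)"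
  shows "finite {\<mu>. {x \<in> S. T x = \<mu> *\<^sub>R x} \<noteq> {0}}
    \<and> (\<Sum>\<mu> | {x \<in> S. T x = \<mu> *\<^sub>R x} \<noteq> {0}. dim {x \<in> S. T x = \<mu> *\<^sub>R x}) = dim S"
  using assms
proof (induction "dim S" arbitrary: S rule: less_induct)
  case less
  let ?E = "\<lambda>S \<mu>. {x \<in> S. T x = \<mu> *\<^sub>R x}"
  show ?case
  proof (cases "S = {0}")
    case True
    then have "?E S \<mu> = {0}" for \<mu> using linear_0[OF T] by auto
    then show ?thesis using True by (simp add: dim_zero_subspace)
  next
    case False
    then obtain x0 \<mu> where x0: "x0 \<in> S" "x0 \<noteq> 0" "T x0 = \<mu> *\<^sub>R x0"
      using self_adjoint_eigenvector_exists[OF less.prems(1,2) False less.prems(3,4)] by blast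
    define E where "E = ?E S \<mu>"
    have E: "subspace E" "E \<subseteq> S"
      using less.prems(1) T unfolding E_def subspace_def
      by (auto simp: linear_add linear_scale linear_0 algebra_simps)
    define S' where "S' = {x \<in> S. \<forall>e\<in>E. ip e x = 0}"
    have dims: "dim S = dim E + dim S'"
      using dim_orthogonal_complement[OF less.prems(1) finF less.prems(2) E] by (simp add: S'_def)
    have S': "subspace S'"
      using less.prems(1) unfolding S'_def subspace_def by (auto simp: ip_simps)
    have "x0 \<in> E" using x0 by (simp add: E_def)
    obtain B where "finite B" "span B = E" "card B = dim E"
      using finite_basis_subspace[OF E(1) finF] E(2) less.prems(2) by blast
    then have "dim E \<noteq> 0"
      using \<open>x0 \<in> E\<close> x0(2) by (cases "B = {}") auto
    then have "dim S' < dim S" using dims by simp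
    moreover have "S' \<subseteq> span F" using less.prems(2) by (auto simp: S'_def)
    moreover have "T x \<in> S'" if "x \<in> S'" for x
    proof -
      have "ip e (T x) = 0" if "e \<in> E" for e
      proof -
        have "ip e (T x) = ip (T e) x"
          using less.prems(4)[of e x] that \<open>x \<in> S'\<close> by (simp add: E_def S'_def)
        also have "\<dots> = 0" using that \<open>x \<in> S'\<close> by (simp add: E_def S'_def ip_simps)
        finally show ?thesis .
      qed
      then show ?thesis using that less.prems(3) by (simp add: S'_def)
    qed
    moreover have "ip (T x) y = ip x (T y)" if "x \<in> S'" "y \<in> S'" for x y
      using that less.prems(4) by (simp add: S'_def)
    ultimately have IH: "finite {\<nu>. ?E S' \<nu> \<noteq> {0}}"
        "(\<Sum>\<nu> | ?E S' \<nu> \<noteq> {0}. dim (?E S' \<nu>)) = dim S'"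
      using less.hyps[of S'] S' by auto
    \<comment> \<open>Eigenvectors for different eigenvalues are orthogonal, so the other
      eigenspaces already lie in \<open>S'\<close>.\<close>
    have eq: "?E S' \<nu> = ?E S \<nu>" if "\<nu> \<noteq> \<mu>" for \<nu>
    proof -
      have "ip e x = 0" if "x \<in> S" "T x = \<nu> *\<^sub>R x" "e \<in> E" for x e
      proof -
        have "\<mu> * ip e x = \<nu> * ip e x"
          using less.prems(4)[of e x] that by (simp add: E_def ip_simps)
        then show ?thesis using \<open>\<nu> \<noteq> \<mu>\<close> by simp
      qed
      then show ?thesis by (auto simp: S'_def)
    qed
    \<comment> \<open>An eigenvector for \<mu> in \<open>S'\<close> would lie in \<open>E\<close>
      and be orthogonal to itself.\<close>
    have "?E S' \<mu> = {0}"
    proof -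
      have "x = 0" if "x \<in> S'" "T x = \<mu> *\<^sub>R x" for x
        using that ip_self_eq_0_iff[of x] by (auto simp: S'_def E_def)
      then show ?thesis using subspace_0[OF S'] linear_0[OF T] by auto
    qed
    moreover have "?E S \<mu> \<noteq> {0}" using x0 by blast
    ultimately have "?E S \<nu> \<noteq> {0} \<longleftrightarrow> \<nu> = \<mu> \<or> ?E S' \<nu> \<noteq> {0}" for \<nu>
      using eq[of \<nu>] by (cases "\<nu> = \<mu>") simp_all
    then have set_eq: "{\<nu>. ?E S \<nu> \<noteq> {0}} = insert \<mu> {\<nu>. ?E S' \<nu> \<noteq> {0}}"
      by (intro set_eqI) (simp only: mem_Collect_eq insert_iff)
    have notin: "\<mu> \<notin> {\<nu>. ?E S' \<nu> \<noteq> {0}}"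
      using \<open>?E S' \<mu> = {0}\<close> by simp
    have "(\<Sum>\<nu> | ?E S \<nu> \<noteq> {0}. dim (?E S \<nu>)) = dim E + (\<Sum>\<nu> | ?E S' \<nu> \<noteq> {0}. dim (?E S \<nu>))"
      unfolding set_eq using IH(1) notin by (simp add: E_def)
    also have "(\<Sum>\<nu> | ?E S' \<nu> \<noteq> {0}. dim (?E S \<nu>)) = (\<Sum>\<nu> | ?E S' \<nu> \<noteq> {0}. dim (?E S' \<nu>))"
    proof (rule sum.cong[OF refl])
      fix \<nu> assume "\<nu> \<in> {\<nu>. ?E S' \<nu> \<noteq> {0}}"
      then have "\<nu> \<noteq> \<mu>" using notin by metis
      then show "dim (?E S \<nu>) = dim (?E S' \<nu>)" using eq[of \<nu>] by simp
    qed
    finally show ?thesis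
      using IH dims set_eq by simp
  qed
qed

end

section \<open>The Laplacian of two consecutive differentials\<close>

text \<open>In the application \<open>d\<close> leads from \<open>S\<close> in degree n to degree n
  - 1, and \<open>d'\<close> leads from \<open>U\<close> in degree n + 1 into
  \<open>S\<close>.\<close>

definition hodge_laplacian ::
    "'b set \<Rightarrow> 'b set \<Rightarrow> ('b \<Rightarrow> 'b) \<Rightarrow> ('b \<Rightarrow> 'b) \<Rightarrow> 'b \<Rightarrow> 'b" where
  "hodge_laplacian S U d d' x = adj S d (d x) + d' (adj U d' x)"

context
  fixes S U F :: "'b set" and d d' :: "'b \<Rightarrow> 'b"
  assumes S: "subspace S" and U: "subspace U"
    and F: "finite F" "S \<subseteq> span F" "U \<subseteq> span F"
    and d: "linear d" "linear d'"
    and chain: "\<And>u. u \<in> U \<Longrightarrow> d' u \<in> S" "\<And>u. u \<in> U \<Longrightarrow> d (d' u) = 0"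
begin

lemmas adjS = adj_mem_ip[OF S F(1,2) d(1)]
lemmas adjU = adj_mem_ip[OF U F(1,3) d(2)]

text \<open>This formula yields self-adjointness and, at x = y, both the nonnegativity of the
  spectrum and the description of the kernel as the vectors killed by \<open>d\<close> and by the
  adjoint of \<open>d'\<close>.\<close>

lemma ip_hodge_laplacian:
  assumes "x \<in> S"
  shows "ip x (hodge_laplacian S U d d' y) = ip (d x) (d y) + ip (adj U d' x) (adj U d' y)"
proof -
  have "ip x (d' (adj U d' y)) = ip (adj U d' x) (adj U d' y)"
    using adjU(2)[of "adj U d' y" x] adjU(1) by (simp add: ip_commute)
  then show ?thesis
    using adjS(2)[OF assms, of "d y"] by (simp add: hodge_laplacian_def ip_simps)
qed

text \<open>The kernel of the Laplacian is the orthogonal complement of the image of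
  \<open>d'\<close> inside the kernel of \<open>d\<close>.\<close>

lemma dim_hodge_kernel:
  "dim S = dim {x \<in> S. hodge_laplacian S U d d' x = 0} + dim (d ` S) + dim (d' ` U)"
proof -
  define K where "K = {x \<in> S. d x = 0}"
  have K: "subspace K" "K \<subseteq> span F"
    using S d(1) F(2) unfolding K_def subspace_def
    by (auto simp: linear_add linear_scale linear_0)
  have I: "subspace (d' ` U)" "d' ` U \<subseteq> K"
    using chain U d(2) by (auto simp: K_def linear_subspace_image)
  have "{x \<in> K. \<forall>e\<in>d' ` U. ip e x = 0} = {x \<in> S. hodge_laplacian S U d d' x = 0}"
  proof -
    have "hodge_laplacian S U d d' x = 0 \<longleftrightarrow> d x = 0 \<and> (\<forall>e\<in>d' ` U. ip e x = 0)" if x: "x \<in> S" for x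
    proof
      assume "hodge_laplacian S U d d' x = 0"
      then have "ip (d x) (d x) + ip (adj U d' x) (adj U d' x) = 0"
        using ip_hodge_laplacian[OF x, of x] by simp
      then have "d x = 0" "adj U d' x = 0"
        using ip_self_nonneg[of "d x"] ip_self_nonneg[of "adj U d' x"]
        by (simp_all add: add_nonneg_eq_0_iff ip_self_eq_0_iff)
      then show "d x = 0 \<and> (\<forall>e\<in>d' ` U. ip e x = 0)"
        using adjU(2)[of _ x] by auto
    next
      assume *: "d x = 0 \<and> (\<forall>e\<in>d' ` U. ip e x = 0)"
      then have "adj U d' x = 0" using adj_eqI[OF U, of 0 d' x] subspace_0[OF U] by simp
      moreover have "adj S d 0 = 0" using adj_eqI[OF S, of 0 d 0] subspace_0[OF S] by simp
      ultimately show "hodge_laplacian S U d d' x = 0"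
        using * linear_0[OF d(2)] by (simp add: hodge_laplacian_def)
    qed
    then show ?thesis by (auto simp: K_def)
  qed
  then have "dim K = dim (d' ` U) + dim {x \<in> S. hodge_laplacian S U d d' x = 0}"
    using dim_orthogonal_complement[OF K(1) F(1) K(2) I] by simp
  then show ?thesis
    using rank_nullity[OF d(1) S F(1,2)] by (simp add: K_def)
qed

text \<open>The eigenspaces fill \<open>S\<close> and no eigenvalue is negative, so the positive
  ones account for the dimension of \<open>S\<close> minus that of the kernel.\<close>

lemma sum_dim_positive_hodge_eigenspaces:
  defines "E \<equiv> \<lambda>\<mu>. {x \<in> S. hodge_laplacian S U d d' x = \<mu> *\<^sub>R x}"
  shows "finite {\<mu>. \<mu> > 0 \<and> E \<mu> \<noteq> {0}}"
    "(\<Sum>\<mu> | \<mu> > 0 \<and> E \<mu> \<noteq> {0}. dim (E \<mu>)) = dim (d ` S) + dim (d' ` U)"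
proof -
  note lin = linear_adj[OF S F(1,2) d(1)] linear_adj[OF U F(1,3) d(2)]
  have L: "linear (hodge_laplacian S U d d')"
    using d lin by (intro linearI) (simp_all add: hodge_laplacian_def linear_add linear_scale scaleR_add_right)
  have inv: "hodge_laplacian S U d d' x \<in> S" if "x \<in> S" for x
    using adjS(1) adjU(1) chain(1) S by (simp add: hodge_laplacian_def subspace_add)
  have sa: "ip (hodge_laplacian S U d d' x) y = ip x (hodge_laplacian S U d d' y)" if "x \<in> S" "y \<in> S" for x y
    using ip_hodge_laplacian[OF that(1), of y] ip_hodge_laplacian[OF that(2), of x]
    by (simp add: ip_commute)
  have spec: "finite {\<mu>. E \<mu> \<noteq> {0}}" "(\<Sum>\<mu> | E \<mu> \<noteq> {0}. dim (E \<mu>)) = dim S"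
    unfolding E_def using sum_dim_eigenspaces[OF L F(1) S F(2)] inv sa by blast+
  have zero: "0 \<in> E \<mu>" for \<mu>
    using subspace_0[OF S] linear_0[OF L] by (simp add: E_def)
  have nonneg: "\<mu> \<ge> 0" if nz: "E \<mu> \<noteq> {0}" for \<mu>
  proof -
    obtain x where x: "x \<in> E \<mu>" "x \<noteq> 0" using nz zero[of \<mu>] by blast
    then have "\<mu> * ip x x = ip (d x) (d x) + ip (adj U d' x) (adj U d' x)"
      using ip_hodge_laplacian[of x x] by (simp add: E_def ip_simps)
    then have "\<mu> * ip x x \<ge> 0" using ip_self_nonneg by simp
    then show ?thesis using ip_pos[OF x(2)] by (simp add: zero_le_mult_iff)
  qed
  show fin: "finite {\<mu>. \<mu> > 0 \<and> E \<mu> \<noteq> {0}}"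
    by (rule finite_subset[OF _ spec(1)]) blast
  have "dim S = (\<Sum>\<mu> | E \<mu> \<noteq> {0}. dim (E \<mu>))" using spec(2) by simp
  \<comment> \<open>The index 0 may be added even if 0 is no eigenvalue: its eigenspace is then {0},
    of dimension 0.\<close>
  also have "\<dots> = (\<Sum>\<mu>\<in>insert 0 {\<mu>. \<mu> > 0 \<and> E \<mu> \<noteq> {0}}. dim (E \<mu>))"
  proof (rule sum.mono_neutral_left)
    show "{\<mu>. E \<mu> \<noteq> {0}} \<subseteq> insert 0 {\<mu>. \<mu> > 0 \<and> E \<mu> \<noteq> {0}}"
      using nonneg by (force simp: less_le)
    show "\<forall>\<mu>\<in>insert 0 {\<mu>. \<mu> > 0 \<and> E \<mu> \<noteq> {0}} - {\<mu>. E \<mu> \<noteq> {0}}. dim (E \<mu>) = 0"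
      by (auto simp: dim_zero_subspace)
  qed (use fin in simp)
  also have "\<dots> = dim (E 0) + (\<Sum>\<mu> | \<mu> > 0 \<and> E \<mu> \<noteq> {0}. dim (E \<mu>))"
    using fin by simp
  finally show "(\<Sum>\<mu> | \<mu> > 0 \<and> E \<mu> \<noteq> {0}. dim (E \<mu>)) = dim (d ` S) + dim (d' ` U)"
    using dim_hodge_kernel by (simp add: E_def)
qed

end

end

section \<open>Boundary operators on path chains\<close>

lemma lookup_scaleR [simp]:
  "Poly_Mapping.lookup (c *\<^sub>R x) i = c *\<^sub>R Poly_Mapping.lookup (x :: 'a \<Rightarrow>\<^sub>0 real) i"
proof -
  have "finite {i. c *\<^sub>R Poly_Mapping.lookup x i \<noteq> 0}"
    by (rule finite_subset[OF _ finite_lookup[of x]]) auto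
  then show ?thesis by (simp add: scaleR_poly_mapping_def Abs_poly_mapping_inverse)
qed

text \<open>Operators prescribed on paths are put in this form, so that they are linear at once and
  identities between them need checking on single paths only.\<close>

definition lin_ext :: "('a list \<Rightarrow> 'b::real_vector) \<Rightarrow> 'a chain \<Rightarrow> 'b" where
  "lin_ext F x = (\<Sum>p\<in>Poly_Mapping.keys x. Poly_Mapping.lookup x p *\<^sub>R F p)"

lemma lin_ext_superset:
  assumes "finite A" "Poly_Mapping.keys x \<subseteq> A"
  shows "lin_ext F x = (\<Sum>p\<in>A. Poly_Mapping.lookup x p *\<^sub>R F p)"
  unfolding lin_ext_def using assms
  by (intro sum.mono_neutral_left) (auto simp: in_keys_iff)

lemma linear_lin_ext [intro!]: "linear (lin_ext F)"
proof (rule linearI)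
  fix x y :: "'a chain" and c :: real
  let ?A = "Poly_Mapping.keys x \<union> Poly_Mapping.keys y"
  have "lin_ext F (x + y) = (\<Sum>p\<in>?A. Poly_Mapping.lookup (x + y) p *\<^sub>R F p)"
    by (rule lin_ext_superset) (auto simp: Poly_Mapping.keys_add)
  also have "\<dots> = lin_ext F x + lin_ext F y"
    by (simp add: lin_ext_superset[of ?A] lookup_add scaleR_add_left sum.distrib)
  finally show "lin_ext F (x + y) = lin_ext F x + lin_ext F y" .
  have "lin_ext F (c *\<^sub>R x) = (\<Sum>p\<in>Poly_Mapping.keys x. Poly_Mapping.lookup (c *\<^sub>R x) p *\<^sub>R F p)"
    by (rule lin_ext_superset) (auto simp: in_keys_iff)
  then show "lin_ext F (c *\<^sub>R x) = c *\<^sub>R lin_ext F x"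
    by (simp add: lin_ext_def scaleR_sum_right)
qed

lemmas lin_ext_simps =
  linear_add[OF linear_lin_ext] linear_scale[OF linear_lin_ext] linear_0[OF linear_lin_ext]
  linear_diff[OF linear_lin_ext] linear_sum[OF linear_lin_ext]

abbreviation path_chain :: "'a list \<Rightarrow> 'a chain" where
  "path_chain p \<equiv> Poly_Mapping.single p 1"

lemma lin_ext_path_chain [simp]: "lin_ext F (path_chain p) = F p"
  by (simp add: lin_ext_def)

lemma lin_ext_id: "lin_ext path_chain x = x"
  by (rule poly_mapping_eqI)
    (simp add: lin_ext_def lookup_sum lookup_single when_def in_keys_iff if_distrib cong: if_cong)

lemma linear_path_chain_eqI:
  assumes "linear \<phi>" "linear \<psi>" "\<And>p. \<phi> (path_chain p) = \<psi> (path_chain p)"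
  shows "\<phi> x = \<psi> x"
proof -
  have "\<phi> (lin_ext path_chain x) = \<psi> (lin_ext path_chain x)"
    using assms by (simp add: lin_ext_def linear_sum linear_scale)
  then show ?thesis by (simp add: lin_ext_id)
qed

lemma regular_part_eq:
  "regular_part = lin_ext (\<lambda>p. if distinct_adj p then path_chain p else 0)"
proof (rule ext)
  fix x :: "'a chain"
  have "c *\<^sub>R path_chain p = Poly_Mapping.single p c" for p :: "'a list" and c :: real
    by (rule poly_mapping_eqI) (simp add: lookup_single when_def)
  then show "regular_part x = lin_ext (\<lambda>p. if distinct_adj p then path_chain p else 0) x"
    unfolding regular_part_def lin_ext_def
    by (intro sum.mono_neutral_cong_left) auto
qed

lemma free_boundary_eq: "free_boundary f n = lin_ext (path_boundary f n)"
  by (simp add: fun_eq_iff free_boundary_def lin_ext_def)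

lemma linear_boundary: "linear (boundary f n)"
proof -
  have "boundary f n = regular_part \<circ> free_boundary f n" by (simp add: fun_eq_iff boundary_def)
  then show ?thesis
    by (simp add: regular_part_eq free_boundary_eq linear_compose linear_lin_ext)
qed

lemma boundary_path_chain: "boundary f n (path_chain p) = regular_part (path_boundary f n p)"
  by (simp add: boundary_def free_boundary_eq)

lemma boundary_degree_0 [simp]: "boundary f 0 x = 0"
proof -
  have "boundary f 0 = (\<lambda>_. 0)"
    by (rule ext, rule linear_path_chain_eqI[OF linear_boundary])
      (simp_all add: boundary_path_chain path_boundary_def regular_part_eq lin_ext_simps linear_zero)
  then show ?thesis by simp
qed

section \<open>The boundary squares to zero and descends to regular paths\<close>

abbreviation cons_chain :: "'a \<Rightarrow> 'a chain \<Rightarrow> 'a chain" where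
  "cons_chain v \<equiv> lin_ext (\<lambda>p. path_chain (v # p))"

text \<open>
  The recursion \<open>\<partial>(vp) = f(v) p - v \<partial>p\<close> makes \<open>\<partial>\<partial> = 0\<close> a simple induction.  It agrees with \<open>path_boundary\<close>
  only in positive degree: here a single vertex \<open>v\<close> has the augmented boundary \<open>f(v)\<close> times the empty path.
\<close>

primrec rec_boundary :: "('a \<Rightarrow> real) \<Rightarrow> 'a list \<Rightarrow> 'a chain" where
  "rec_boundary f [] = 0"
| "rec_boundary f (v # p) = f v *\<^sub>R path_chain p - cons_chain v (rec_boundary f p)"

lemma rec_boundary_eq_sum:
  "rec_boundary f p =
    (\<Sum>i<length p. ((-1) ^ i * f (p ! i)) *\<^sub>R path_chain (delete_vertex i p))"
proof (induction p)
  case (Cons v p)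
  have "cons_chain v (rec_boundary f p) =
      (\<Sum>i<length p. ((-1) ^ i * f (p ! i)) *\<^sub>R path_chain (delete_vertex (Suc i) (v # p)))"
    by (simp add: Cons lin_ext_simps delete_vertex_def)
  then show ?case
    by (simp add: sum.lessThan_Suc_shift sum_negf delete_vertex_def del: sum.lessThan_Suc)
qed simp

lemma path_boundary_eq_rec_boundary:
  assumes "n > 0" "length p = n + 1"
  shows "path_boundary f n p = rec_boundary f p"
  using assms by (simp add: path_boundary_def rec_boundary_eq_sum atLeast0AtMost lessThan_Suc_atMost)

abbreviation full_boundary :: "('a \<Rightarrow> real) \<Rightarrow> 'a chain \<Rightarrow> 'a chain" where
  "full_boundary f \<equiv> lin_ext (rec_boundary f)"

lemma full_boundary_cons_chain:
  "full_boundary f (cons_chain v x) = f v *\<^sub>R x - cons_chain v (full_boundary f x)"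
  by (rule linear_path_chain_eqI)
    (auto intro!: linearI simp: lin_ext_simps algebra_simps)

text \<open>For a path v p the two copies of f(v) times the boundary of \<open>p\<close> cancel,
  leaving v prepended to the double boundary of \<open>p\<close>.\<close>

lemma full_boundary_rec_boundary: "full_boundary f (rec_boundary f p) = 0"
  by (induction p) (simp_all add: lin_ext_simps full_boundary_cons_chain)

lemma full_boundary_full_boundary: "full_boundary f (full_boundary f x) = 0"
  by (rule linear_path_chain_eqI)
    (auto intro!: linearI simp: lin_ext_simps full_boundary_rec_boundary)

lemma regular_part_path_chain:
  "regular_part (path_chain p) = (if distinct_adj p then path_chain p else 0)"
  by (simp add: regular_part_eq)

lemmas regular_part_simps = lin_ext_simps[of "\<lambda>p. if distinct_adj p then path_chain p else 0",
  folded regular_part_eq]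

text \<open>Prepending a vertex keeps irregular paths irregular, so it is well defined on the
  quotient.\<close>

lemma regular_part_cons_chain:
  "regular_part (cons_chain v (regular_part x)) = regular_part (cons_chain v x)"
proof (rule linear_path_chain_eqI[where \<psi> = "\<lambda>x. regular_part (cons_chain v x)"])
  show "linear (\<lambda>x. regular_part (cons_chain v (regular_part x)))"
    "linear (\<lambda>x. regular_part (cons_chain v x))"
    by (rule linearI; simp add: lin_ext_simps regular_part_simps)+
  show "regular_part (cons_chain v (regular_part (path_chain p))) =
      regular_part (cons_chain v (path_chain p))" for p
    using distinct_adj_ConsD[of v p] by (simp add: regular_part_path_chain regular_part_simps lin_ext_simps)
qed

lemma regular_part_cons_chain_twice: "regular_part (cons_chain v (cons_chain v x)) = 0"
proof (rule linear_path_chain_eqI[where \<phi> = "\<lambda>x. regular_part (cons_chain v (cons_chain v x))"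
      and \<psi> = "\<lambda>_. 0"])
  show "linear (\<lambda>x. regular_part (cons_chain v (cons_chain v x)))"
    by (rule linearI) (simp_all add: lin_ext_simps regular_part_simps)
qed (simp_all add: regular_part_path_chain linear_zero)

text \<open>If the path begins with v v, the deletions of these two vertices cancel and all other
  terms still begin with v v; otherwise the repetition lies in the tail and induction
  applies.\<close>

lemma regular_part_rec_boundary_irregular:
  "\<not> distinct_adj p \<Longrightarrow> regular_part (rec_boundary f p) = 0"
proof (induction p)
  case (Cons v q)
  then obtain w r where q: "q = w # r" by (cases q) auto
  show ?case
  proof (cases "v = w")
    case True
    then show ?thesis
      by (simp add: q lin_ext_simps regular_part_simps regular_part_cons_chain_twice)
  next
    case False
    then have "\<not> distinct_adj q" using Cons.prems q by simp
    then have "regular_part (cons_chain v (rec_boundary f q)) = 0"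
      using Cons.IH regular_part_cons_chain[of v "rec_boundary f q"]
      by (simp add: lin_ext_simps regular_part_simps)
    then show ?thesis
      using \<open>\<not> distinct_adj q\<close> by (simp add: regular_part_simps regular_part_path_chain)
  qed
qed simp

lemma regular_part_full_boundary:
  "regular_part (full_boundary f (regular_part x)) = regular_part (full_boundary f x)"
proof (rule linear_path_chain_eqI[where \<psi> = "\<lambda>x. regular_part (full_boundary f x)"])
  show "linear (\<lambda>x. regular_part (full_boundary f (regular_part x)))"
    "linear (\<lambda>x. regular_part (full_boundary f x))"
    by (rule linearI; simp add: lin_ext_simps regular_part_simps)+
  show "regular_part (full_boundary f (regular_part (path_chain p))) =
      regular_part (full_boundary f (path_chain p))" for p
    by (simp add: regular_part_path_chain regular_part_simps lin_ext_simps
        regular_part_rec_boundary_irregular)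
qed

lemma allowed_chains_linear_eqI:
  assumes "linear \<phi>" "linear \<psi>" "x \<in> allowed_chains G n"
    "\<And>p. p \<in> allowed_paths G n \<Longrightarrow> \<phi> (path_chain p) = \<psi> (path_chain p)"
  shows "\<phi> x = \<psi> x"
  using linear_eq_on[OF assms(1,2), of x "path_chain ` allowed_paths G n"] assms(3,4)
  by (auto simp: allowed_chains_def)

text \<open>Positive degree excludes the augmentation of single vertices, and allowed chains contain
  only lists of length n + 1, the range over which \<open>path_boundary\<close> sums.\<close>

lemma boundary_eq_full_boundary:
  assumes "n > 0" "x \<in> allowed_chains G n"
  shows "boundary f n x = regular_part (full_boundary f x)"
proof (rule allowed_chains_linear_eqI[OF linear_boundary _ assms(2)])
  show "linear (\<lambda>x. regular_part (full_boundary f x))"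
    by (rule linearI) (simp_all add: lin_ext_simps regular_part_simps)
  show "boundary f n (path_chain p) = regular_part (full_boundary f (path_chain p))"
    if "p \<in> allowed_paths G n" for p
    using that assms(1)
    by (simp add: boundary_path_chain path_boundary_eq_rec_boundary allowed_paths_def)
qed

lemma boundary_boundary:
  assumes "x \<in> Omega G f (Suc n)"
  shows "boundary f n (boundary f (Suc n) x) = 0"
\<comment> \<open>In degree 0 the outer boundary is 0 by convention, whereas
  \<open>full_boundary\<close> would be the augmentation.\<close>
proof (cases "n = 0")
  case False
  have x: "x \<in> allowed_chains G (Suc n)" "boundary f (Suc n) x \<in> allowed_chains G n"
    using assms by (simp_all add: Omega_def)
  then have "boundary f n (boundary f (Suc n) x) =
      regular_part (full_boundary f (regular_part (full_boundary f x)))"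
    using False boundary_eq_full_boundary[of n _ G f] boundary_eq_full_boundary[of "Suc n" x G f]
    by auto
  then show ?thesis
    by (simp add: regular_part_full_boundary full_boundary_full_boundary regular_part_simps)
qed simp

lemma boundary_mem_Omega:
  assumes "x \<in> Omega G f (Suc n)"
  shows "boundary f (Suc n) x \<in> Omega G f n"
  using assms boundary_boundary[OF assms]
  by (simp add: Omega_def allowed_chains_def span_zero)

lemma subspace_Omega: "subspace (Omega G f n)"
  unfolding Omega_def subspace_def allowed_chains_def
  by (auto simp: linear_0[OF linear_boundary] linear_add[OF linear_boundary]
      linear_scale[OF linear_boundary] span_zero span_add span_scale)

section \<open>Rescaling paths by vertex weights\<close>

definition vertex_scale :: "('a \<Rightarrow> real) \<Rightarrow> 'a chain \<Rightarrow> 'a chain" where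
  "vertex_scale h = lin_ext (\<lambda>p. prod_list (map h p) *\<^sub>R path_chain p)"

lemma linear_vertex_scale: "linear (vertex_scale h)"
  unfolding vertex_scale_def by (rule linear_lin_ext)

lemma vertex_scale_path_chain:
  "vertex_scale h (path_chain p) = prod_list (map h p) *\<^sub>R path_chain p"
  by (simp add: vertex_scale_def)

lemmas vertex_scale_simps = linear_0[OF linear_vertex_scale] linear_add[OF linear_vertex_scale]
  linear_scale[OF linear_vertex_scale] linear_diff[OF linear_vertex_scale]

lemma lookup_vertex_scale:
  "Poly_Mapping.lookup (vertex_scale h x) p = prod_list (map h p) * Poly_Mapping.lookup x p"
  by (simp add: vertex_scale_def lin_ext_def lookup_sum lookup_single when_def in_keys_iff
      if_distrib cong: if_cong)

lemma vertex_scale_inverse: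
  assumes "\<And>v. h v \<noteq> 0"
  shows "vertex_scale h (vertex_scale (\<lambda>v. inverse (h v)) x) = x"
    "vertex_scale (\<lambda>v. inverse (h v)) (vertex_scale h x) = x"
proof -
  have "prod_list (map h p) * prod_list (map (\<lambda>v. inverse (h v)) p) = 1" for p
  proof (induction p)
    case (Cons v p)
    have "prod_list (map h (v # p)) * prod_list (map (\<lambda>v. inverse (h v)) (v # p)) =
        (h v * inverse (h v)) * (prod_list (map h p) * prod_list (map (\<lambda>v. inverse (h v)) p))"
      by simp
    then show ?case using Cons assms by simp
  qed simp
  then have *: "prod_list (map h p) * (prod_list (map (\<lambda>v. inverse (h v)) p) * c) = c"
    "prod_list (map (\<lambda>v. inverse (h v)) p) * (prod_list (map h p) * c) = c" for p c
    by (simp_all add: mult.assoc[symmetric] mult.commute[of "prod_list (map (\<lambda>v. inverse (h v)) p)"])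
  show "vertex_scale h (vertex_scale (\<lambda>v. inverse (h v)) x) = x"
    "vertex_scale (\<lambda>v. inverse (h v)) (vertex_scale h x) = x"
    by (rule poly_mapping_eqI, simp only: lookup_vertex_scale *)+
qed

lemma bij_vertex_scale:
  assumes "\<And>v. h v \<noteq> 0"
  shows "bij (vertex_scale h)"
  by (rule o_bij[of "vertex_scale (\<lambda>v. inverse (h v))"])
    (simp_all add: fun_eq_iff vertex_scale_inverse assms)

lemma vertex_scale_cons_chain:
  "vertex_scale h (cons_chain v x) = h v *\<^sub>R cons_chain v (vertex_scale h x)"
proof (rule linear_path_chain_eqI[where \<phi> = "\<lambda>x. vertex_scale h (cons_chain v x)"
      and \<psi> = "\<lambda>x. h v *\<^sub>R cons_chain v (vertex_scale h x)"])
  show "linear (\<lambda>x. vertex_scale h (cons_chain v x))"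
    "linear (\<lambda>x. h v *\<^sub>R cons_chain v (vertex_scale h x))"
    by (rule linearI; simp add: lin_ext_simps vertex_scale_simps scaleR_add_right)+
qed (simp add: vertex_scale_path_chain lin_ext_simps)

text \<open>Deleting a vertex v removes the factor h(v) from the product, and the weight f(v) h(v)
  restores exactly this factor.\<close>

lemma vertex_scale_rec_boundary:
  "vertex_scale h (rec_boundary (\<lambda>v. f v * h v) p) = prod_list (map h p) *\<^sub>R rec_boundary f p"
proof (induction p)
  case (Cons v p)
  then show ?case
    by (simp add: vertex_scale_simps vertex_scale_path_chain vertex_scale_cons_chain lin_ext_simps
        scaleR_diff_right mult_ac)
qed (simp add: vertex_scale_simps)

lemma vertex_scale_regular_part: "vertex_scale h (regular_part x) = regular_part (vertex_scale h x)"
proof (rule linear_path_chain_eqI[where \<phi> = "\<lambda>x. vertex_scale h (regular_part x)"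
      and \<psi> = "\<lambda>x. regular_part (vertex_scale h x)"])
  show "linear (\<lambda>x. vertex_scale h (regular_part x))" "linear (\<lambda>x. regular_part (vertex_scale h x))"
    by (rule linearI; simp add: regular_part_simps vertex_scale_simps)+
qed (simp add: vertex_scale_path_chain regular_part_path_chain regular_part_simps vertex_scale_simps)

lemma vertex_scale_full_boundary:
  "vertex_scale h (full_boundary (\<lambda>v. f v * h v) x) = full_boundary f (vertex_scale h x)"
proof (rule linear_path_chain_eqI[where \<phi> = "\<lambda>x. vertex_scale h (full_boundary (\<lambda>v. f v * h v) x)"
      and \<psi> = "\<lambda>x. full_boundary f (vertex_scale h x)"])
  show "linear (\<lambda>x. vertex_scale h (full_boundary (\<lambda>v. f v * h v) x))"
    "linear (\<lambda>x. full_boundary f (vertex_scale h x))"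
    by (rule linearI; simp add: lin_ext_simps vertex_scale_simps)+
qed (simp add: vertex_scale_path_chain vertex_scale_rec_boundary lin_ext_simps)

lemma vertex_scale_allowed_chains:
  assumes "x \<in> allowed_chains G n"
  shows "vertex_scale h x \<in> allowed_chains G n"
proof -
  have "x \<in> span (path_chain ` allowed_paths G n)" using assms by (simp add: allowed_chains_def)
  then have "vertex_scale h x \<in> span (path_chain ` allowed_paths G n)"
  proof (induction rule: span_induct_alt)
    case (step c y z)
    then obtain p where "p \<in> allowed_paths G n" "y = path_chain p" by blast
    then show ?case
      using step by (simp add: vertex_scale_simps vertex_scale_path_chain span_add span_scale span_base)
  qed (simp add: vertex_scale_simps span_zero)
  then show ?thesis by (simp add: allowed_chains_def)
qed

lemma vertex_scale_boundary:
  assumes "x \<in> allowed_chains G n"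
  shows "vertex_scale h (boundary (\<lambda>v. f v * h v) n x) = boundary f n (vertex_scale h x)"
proof (cases "n = 0")
  case False
  then show ?thesis
    using boundary_eq_full_boundary[OF _ assms, of "\<lambda>v. f v * h v"]
      boundary_eq_full_boundary[OF _ vertex_scale_allowed_chains[OF assms], of f h]
    by (simp add: vertex_scale_regular_part vertex_scale_full_boundary)
qed (simp add: vertex_scale_simps)

lemma vertex_scale_allowed_chains_iff:
  assumes "\<And>v. h v \<noteq> 0"
  shows "vertex_scale h x \<in> allowed_chains G n \<longleftrightarrow> x \<in> allowed_chains G n"
proof
  assume "vertex_scale h x \<in> allowed_chains G n"
  from vertex_scale_allowed_chains[OF this, of "\<lambda>v. inverse (h v)"]
  show "x \<in> allowed_chains G n" by (simp only: vertex_scale_inverse(2)[of h, OF assms])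
qed (rule vertex_scale_allowed_chains)

lemma vertex_scale_Omega_iff:
  assumes "\<And>v. h v \<noteq> 0"
  shows "vertex_scale h x \<in> Omega G f n \<longleftrightarrow> x \<in> Omega G (\<lambda>v. f v * h v) n"
proof -
  have "boundary f n (vertex_scale h x) = vertex_scale h (boundary (\<lambda>v. f v * h v) n x)"
    if "x \<in> allowed_chains G n"
    using vertex_scale_boundary[OF that] by simp
  then show ?thesis
    unfolding Omega_def by (auto simp: vertex_scale_allowed_chains_iff assms)
qed

lemma vertex_scale_image_Omega:
  assumes "\<And>v. h v \<noteq> 0"
  shows "vertex_scale h ` Omega G (\<lambda>v. f v * h v) n = Omega G f n"
proof (rule set_eqI)
  fix y
  obtain x where y: "y = vertex_scale h x"
    by (rule surjE[OF bij_is_surj[OF bij_vertex_scale[of h, OF assms]]])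
  have "inj (vertex_scale h)" by (rule bij_is_inj[OF bij_vertex_scale[OF assms]])
  then show "y \<in> vertex_scale h ` Omega G (\<lambda>v. f v * h v) n \<longleftrightarrow> y \<in> Omega G f n"
    using vertex_scale_Omega_iff[of h x G f n] assms by (simp add: y inj_image_mem_iff)
qed

section \<open>The weighted inner product on chains\<close>

text \<open>
  \<open>chain_inner\<close> is symmetric only on chains of one degree (it pairs a path with its proper extensions);
  this diagonal form agrees with it there and is an inner product on all chains.
\<close>

definition path_ip :: "('a \<Rightarrow> real) \<Rightarrow> 'a chain \<Rightarrow> 'a chain \<Rightarrow> real" where
  "path_ip g x y = lin_ext (\<lambda>p. Poly_Mapping.lookup y p * (prod_list (map g p))\<^sup>2) x"

lemma path_ip_superset:
  assumes "finite A" "Poly_Mapping.keys x \<subseteq> A"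
  shows "path_ip g x y = (\<Sum>p\<in>A. Poly_Mapping.lookup x p * Poly_Mapping.lookup y p * (prod_list (map g p))\<^sup>2)"
  unfolding path_ip_def by (simp add: lin_ext_superset[OF assms] mult.assoc)

lemma inner_form_path_ip:
  assumes "\<And>v. g v \<noteq> 0"
  shows "inner_form (path_ip g)"
proof
  fix x y z :: "'a chain" and c :: real
  let ?A = "Poly_Mapping.keys x \<union> Poly_Mapping.keys y"
  show "path_ip g x y = path_ip g y x"
    by (simp add: path_ip_superset[of ?A] mult.commute)
  show "path_ip g (x + y) z = path_ip g x z + path_ip g y z"
    "path_ip g (c *\<^sub>R x) y = c * path_ip g x y"
    by (simp_all add: path_ip_def lin_ext_simps)
  assume "x \<noteq> 0"
  then obtain p where p: "p \<in> Poly_Mapping.keys x" by fastforce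
  have nz: "prod_list (map g q) \<noteq> 0" for q by (induction q) (simp_all add: assms)
  have "path_ip g x x = (\<Sum>p\<in>Poly_Mapping.keys x. (Poly_Mapping.lookup x p * prod_list (map g p))\<^sup>2)"
    by (simp add: path_ip_superset[of "Poly_Mapping.keys x"] power2_eq_square mult_ac)
  also have "\<dots> > 0"
    by (rule sum_pos2[OF _ p]) (use p nz[of p] in \<open>simp_all add: in_keys_iff\<close>)
  finally show "path_ip g x x > 0" .
qed

lemma path_ip_vertex_scale:
  "path_ip (\<lambda>v. g v * h v) x y = path_ip g (vertex_scale h x) (vertex_scale h y)"
proof -
  have "Poly_Mapping.keys (vertex_scale h x) \<subseteq> Poly_Mapping.keys x"
    by (auto simp: in_keys_iff lookup_vertex_scale)
  moreover have "prod_list (map (\<lambda>v. g v * h v) p) = prod_list (map g p) * prod_list (map h p)" for p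
    by (induction p) (simp_all add: mult_ac)
  ultimately show ?thesis
    by (simp add: path_ip_superset[of "Poly_Mapping.keys x"] lookup_vertex_scale
        power2_eq_square mult_ac)
qed

lemma keys_allowed_chains:
  assumes "x \<in> allowed_chains G n"
  shows "Poly_Mapping.keys x \<subseteq> allowed_paths G n"
proof -
  have "x \<in> span (path_chain ` allowed_paths G n)" using assms by (simp add: allowed_chains_def)
  then show ?thesis
  proof (induction rule: span_induct_alt)
    case (step c y z)
    then obtain p where p: "p \<in> allowed_paths G n" "y = path_chain p" by blast
    have "Poly_Mapping.keys (c *\<^sub>R y + z) \<subseteq> insert p (Poly_Mapping.keys z)"
      by (auto simp: p in_keys_iff lookup_add lookup_single when_def split: if_splits)
    then show ?case using step p by blast
  qed simp
qed

lemma path_inner_eq: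
  assumes "length p = length q"
  shows "path_inner g p q = (if p = q then (prod_list (map g p))\<^sup>2 else 0)"
proof (cases "p = q")
  case True
  have "prod_list (map g q) = (\<Prod>i<length q. g (q ! i))"
    by (simp add: prod.list_conv_set_nth atLeast0LessThan)
  then show ?thesis using True by (simp add: path_inner_def power2_eq_square prod.distrib)
next
  case False
  then obtain i where "i < length p" "p ! i \<noteq> q ! i" using assms nth_equalityI by blast
  then show ?thesis using False by (auto simp: path_inner_def intro!: prod_zero)
qed

text \<open>Within one degree all paths have the same length, so \<open>path_inner\<close> vanishes
  off the diagonal.\<close>

lemma chain_inner_eq_path_ip:
  assumes "x \<in> allowed_chains G n" "y \<in> allowed_chains G n"
  shows "chain_inner g x y = path_ip g x y"
proof -
  have "chain_inner g x y = (\<Sum>p\<in>Poly_Mapping.keys x. \<Sum>q\<in>Poly_Mapping.keys y.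
      if p = q then Poly_Mapping.lookup x p * Poly_Mapping.lookup y q * (prod_list (map g p))\<^sup>2 else 0)"
    unfolding chain_inner_def
  proof (intro sum.cong refl)
    fix p q assume "p \<in> Poly_Mapping.keys x" "q \<in> Poly_Mapping.keys y"
    then have "p \<in> allowed_paths G n" "q \<in> allowed_paths G n"
      using keys_allowed_chains[OF assms(1)] keys_allowed_chains[OF assms(2)] by blast+
    then have "length p = length q" by (simp add: allowed_paths_def)
    then show "Poly_Mapping.lookup x p * Poly_Mapping.lookup y q * path_inner g p q =
      (if p = q then Poly_Mapping.lookup x p * Poly_Mapping.lookup y q * (prod_list (map g p))\<^sup>2 else 0)"
      by (simp add: path_inner_eq)
  qed
  also have "\<dots> = (\<Sum>p\<in>Poly_Mapping.keys x.
      Poly_Mapping.lookup x p * Poly_Mapping.lookup y p * (prod_list (map g p))\<^sup>2)"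
    by (rule sum.cong) (auto simp: in_keys_iff)
  also have "\<dots> = path_ip g x y" by (simp add: path_ip_superset[of "Poly_Mapping.keys x"])
  finally show ?thesis .
qed

text \<open>Both definite descriptions only compare pairings inside a single degree, where the two
  forms agree.\<close>

lemma boundary_adjoint_eq_adj:
  assumes "inner_form (path_ip g)" "y \<in> allowed_chains G (n - 1)"
  shows "boundary_adjoint G f g n y = inner_form.adj (path_ip g) (Omega G f n) (boundary f n) y"
proof -
  have "x \<in> Omega G f n \<and> (\<forall>u\<in>Omega G f n. chain_inner g u x = chain_inner g (boundary f n u) y) \<longleftrightarrow>
    x \<in> Omega G f n \<and> (\<forall>u\<in>Omega G f n. path_ip g u x = path_ip g (boundary f n u) y)" for x
    using assms(2) chain_inner_eq_path_ip[of _ G n x g] chain_inner_eq_path_ip[of _ G "n - 1" y g]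
    by (auto simp: Omega_def)
  then show ?thesis
    unfolding boundary_adjoint_def inner_form.adj_def[OF assms(1)] by simp
qed

abbreviation chain_laplacian where
  "chain_laplacian G f g n \<equiv> inner_form.hodge_laplacian (path_ip g) (Omega G f n) (Omega G f (n + 1))
     (boundary f n) (boundary f (n + 1))"

lemma Laplacian_eq_hodge_laplacian:
  assumes "inner_form (path_ip g)" "x \<in> Omega G f n"
  shows "Laplacian G f g n x = chain_laplacian G f g n x"
proof -
  have "x \<in> allowed_chains G n" "boundary f n x \<in> allowed_chains G (n - 1)"
    using assms(2) by (simp_all add: Omega_def)
  then show ?thesis
    using assms(1)
    by (simp add: Laplacian_def inner_form.hodge_laplacian_def boundary_adjoint_eq_adj)
qed

section \<open>Zeta functions and torsion\<close>

lemma finite_allowed_paths: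
  assumes "pair_digraph G"
  shows "finite (allowed_paths G n)"
proof -
  interpret pair_digraph G by fact
  show ?thesis
    by (rule finite_subset[OF _ finite_lists_length_eq[OF pair_finite_verts, of "n + 1"]])
      (auto simp: allowed_paths_def)
qed

text \<open>One finite set serves two consecutive degrees, as required by the abstract Laplacian
  results with their common \<open>F\<close>.\<close>

lemma Omega_finite_span:
  assumes "pair_digraph G"
  obtains F where "finite F" "Omega G f n \<subseteq> span F" "Omega G f (n + 1) \<subseteq> span F"
proof
  let ?F = "path_chain ` (allowed_paths G n \<union> allowed_paths G (n + 1))"
  show "finite ?F" using finite_allowed_paths[OF assms] by simp
  show "Omega G f n \<subseteq> span ?F" "Omega G f (n + 1) \<subseteq> span ?F"
    using span_mono[of "path_chain ` allowed_paths G n" ?F]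
      span_mono[of "path_chain ` allowed_paths G (n + 1)" ?F]
    by (auto simp: Omega_def allowed_chains_def)
qed

lemma eigenspace_eq_hodge:
  assumes "inner_form (path_ip g)"
  shows "eigenspace G f g n \<mu> = {x \<in> Omega G f n. chain_laplacian G f g n x = \<mu> *\<^sub>R x}"
  unfolding eigenspace_def
  by (intro Collect_cong conj_cong refl) (simp only: Laplacian_eq_hodge_laplacian[OF assms])

lemma sum_dim_positive_eigenspaces:
  assumes G: "pair_digraph G" and g: "\<And>v. g v \<noteq> 0"
  shows "finite {\<mu>. \<mu> > 0 \<and> eigenspace G f g n \<mu> \<noteq> {0}}"
    "(\<Sum>\<mu> | \<mu> > 0 \<and> eigenspace G f g n \<mu> \<noteq> {0}. dim (eigenspace G f g n \<mu>)) =
      dim (boundary f n ` Omega G f n) + dim (boundary f (n + 1) ` Omega G f (n + 1))"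
proof -
  obtain F where F: "finite F" "Omega G f n \<subseteq> span F" "Omega G f (n + 1) \<subseteq> span F"
    by (rule Omega_finite_span[OF G])
  note ip = inner_form_path_ip[of g, OF g]
  note * = inner_form.sum_dim_positive_hodge_eigenspaces[OF ip subspace_Omega subspace_Omega F
      linear_boundary linear_boundary]
  show "finite {\<mu>. \<mu> > 0 \<and> eigenspace G f g n \<mu> \<noteq> {0}}"
    unfolding eigenspace_eq_hodge[OF ip]
    by (rule *(1)) (simp_all add: boundary_mem_Omega boundary_boundary)
  show "(\<Sum>\<mu> | \<mu> > 0 \<and> eigenspace G f g n \<mu> \<noteq> {0}. dim (eigenspace G f g n \<mu>)) =
      dim (boundary f n ` Omega G f n) + dim (boundary f (n + 1) ` Omega G f (n + 1))"
    unfolding eigenspace_eq_hodge[OF ip]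
    by (rule *(2)) (simp_all add: boundary_mem_Omega boundary_boundary)
qed

lemma adj_Omega:
  assumes "pair_digraph G" "\<And>v. g v \<noteq> 0"
  shows "inner_form.adj (path_ip g) (Omega G f n) (boundary f n) y \<in> Omega G f n"
    "u \<in> Omega G f n \<Longrightarrow>
      path_ip g u (inner_form.adj (path_ip g) (Omega G f n) (boundary f n) y) = path_ip g (boundary f n u) y"
proof -
  obtain F where F: "finite F" "Omega G f n \<subseteq> span F" "Omega G f (n + 1) \<subseteq> span F"
    by (rule Omega_finite_span[OF assms(1)])
  note * = inner_form.adj_mem_ip[OF inner_form_path_ip[of g, OF assms(2)] subspace_Omega F(1,2)
      linear_boundary]
  show "inner_form.adj (path_ip g) (Omega G f n) (boundary f n) y \<in> Omega G f n"
    "u \<in> Omega G f n \<Longrightarrow>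
      path_ip g u (inner_form.adj (path_ip g) (Omega G f n) (boundary f n) y) = path_ip g (boundary f n u) y"
    by (rule *; assumption)+
qed

text \<open>The value of \<open>deriv\<close> is meaningful only where a derivative exists; here
  \<open>zeta\<close> is a finite sum of exponentials in s.\<close>

lemma zeta_differentiable:
  assumes "finite {\<mu>. \<mu> > 0 \<and> eigenspace G f g n \<mu> \<noteq> {0}}"
  shows "zeta G f g n differentiable (at 0)"
proof -
  have "((\<lambda>s. \<mu> powr (- s)) has_real_derivative - ln \<mu>) (at 0)" if "\<mu> > 0" for \<mu> :: real
  proof -
    have "(\<lambda>s. \<mu> powr (- s)) = (\<lambda>s. exp (- s * ln \<mu>))" using that by (simp add: powr_def)
    moreover have "((\<lambda>s. exp (- s * ln \<mu>)) has_real_derivative - ln \<mu>) (at 0)"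
      by (auto intro!: derivative_eq_intros)
    ultimately show ?thesis by simp
  qed
  then have "((\<lambda>s. \<Sum>\<mu> | \<mu> > 0 \<and> eigenspace G f g n \<mu> \<noteq> {0}.
      real (dim (eigenspace G f g n \<mu>)) * \<mu> powr (- s)) has_real_derivative
      (\<Sum>\<mu> | \<mu> > 0 \<and> eigenspace G f g n \<mu> \<noteq> {0}. real (dim (eigenspace G f g n \<mu>)) * - ln \<mu>)) (at 0)"
    by (intro DERIV_sum DERIV_cmult) auto
  then show ?thesis
    unfolding zeta_def[abs_def] real_differentiable_def by blast
qed

text \<open>At s = 0 every power is 1, so \<open>zeta\<close> counts the positive eigenvalues with
  multiplicity.\<close>

lemma zeta_0:
  assumes "pair_digraph G" "\<And>v. g v \<noteq> 0"
  shows "zeta G f g n 0 =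
    real (dim (boundary f n ` Omega G f n) + dim (boundary f (n + 1) ` Omega G f (n + 1)))"
proof -
  have "zeta G f g n 0 = real (\<Sum>\<mu> | \<mu> > 0 \<and> eigenspace G f g n \<mu> \<noteq> {0}. dim (eigenspace G f g n \<mu>))"
    unfolding zeta_def of_nat_sum by (rule sum.cong) auto
  then show ?thesis using sum_dim_positive_eigenspaces(2)[of G g f n] assms by simp
qed

section \<open>Scaling the inner product by a constant\<close>

lemma path_ip_scale:
  assumes "x \<in> allowed_chains G n"
  shows "path_ip (\<lambda>v. c * g v) x y = c\<^sup>2 ^ (n + 1) * path_ip g x y"
proof -
  have *: "prod_list (map (\<lambda>v. c * g v) p) = c ^ length p * prod_list (map g p)" for p
    by (induction p) (simp_all add: mult_ac)
  have "(prod_list (map (\<lambda>v. c * g v) p))\<^sup>2 = c\<^sup>2 ^ (n + 1) * (prod_list (map g p))\<^sup>2"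
    if "p \<in> Poly_Mapping.keys x" for p
  proof -
    have "p \<in> allowed_paths G n" using keys_allowed_chains[OF assms] that by blast
    then have "prod_list (map (\<lambda>v. c * g v) p) = c ^ (n + 1) * prod_list (map g p)"
      using * by (simp add: allowed_paths_def)
    then show ?thesis
      by (simp only: power_mult_distrib power_mult[symmetric] mult.commute[of 2])
  qed
  then show ?thesis
    by (simp add: path_ip_superset[of "Poly_Mapping.keys x"] sum_distrib_left mult_ac)
qed

text \<open>The form gains c^(2(n+1)) in degree n but only c^(2n) in degree n - 1, and the adjoint
  absorbs the quotient.\<close>

lemma adj_weight_scale:
  assumes G: "pair_digraph G" and g: "\<And>v. g v \<noteq> 0" and c: "c \<noteq> 0"
  shows "inner_form.adj (path_ip (\<lambda>v. c * g v)) (Omega G f n) (boundary f n) y =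
    inverse (c\<^sup>2) *\<^sub>R inner_form.adj (path_ip g) (Omega G f n) (boundary f n) y"
proof (rule inner_form.adj_eqI)
  show "inner_form (path_ip (\<lambda>v. c * g v))" by (rule inner_form_path_ip) (simp add: g c)
  show "subspace (Omega G f n)" by (rule subspace_Omega)
  note adj = adj_Omega[where g = g and f = f and n = n, OF G g]
  let ?a = "inner_form.adj (path_ip g) (Omega G f n) (boundary f n) y"
  show "inverse (c\<^sup>2) *\<^sub>R ?a \<in> Omega G f n"
    by (rule subspace_scale[OF subspace_Omega adj(1)])
  interpret inner_form "path_ip g" by (rule inner_form_path_ip) (rule g)
  fix u assume u: "u \<in> Omega G f n"
  then have u': "u \<in> allowed_chains G n" "boundary f n u \<in> allowed_chains G (n - 1)"
    by (simp_all add: Omega_def)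
  have "path_ip (\<lambda>v. c * g v) u (inverse (c\<^sup>2) *\<^sub>R ?a) = c\<^sup>2 ^ n * path_ip g (boundary f n u) y"
    using c by (simp add: path_ip_scale[OF u'(1)] ip_scale_right adj(2)[OF u])
  \<comment> \<open>For n = 0 the truncated n - 1 would give the wrong power of c, but both sides
    vanish because the boundary does.\<close>
  also have "\<dots> = path_ip (\<lambda>v. c * g v) (boundary f n u) y"
    using path_ip_scale[OF u'(2), of c g y] by (cases n) (simp_all add: path_ip_def lin_ext_simps)
  finally show "path_ip (\<lambda>v. c * g v) u (inverse (c\<^sup>2) *\<^sub>R ?a) =
    path_ip (\<lambda>v. c * g v) (boundary f n u) y" .
qed

lemma eigenspace_weight_scale:
  assumes G: "pair_digraph G" and g: "\<And>v. g v \<noteq> 0" and c: "c \<noteq> 0"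
  shows "eigenspace G f (\<lambda>v. c * g v) n \<mu> = eigenspace G f g n (c\<^sup>2 * \<mu>)"
proof -
  note ip = inner_form_path_ip[of g, OF g]
  have ip': "inner_form (path_ip (\<lambda>v. c * g v))" by (rule inner_form_path_ip) (simp add: g c)
  have "chain_laplacian G f (\<lambda>v. c * g v) n x = inverse (c\<^sup>2) *\<^sub>R chain_laplacian G f g n x" for x
    unfolding inner_form.hodge_laplacian_def[OF ip] inner_form.hodge_laplacian_def[OF ip']
      adj_weight_scale[OF assms] linear_scale[OF linear_boundary] scaleR_add_right ..
  moreover have "inverse (c\<^sup>2) *\<^sub>R y = \<mu> *\<^sub>R x \<longleftrightarrow> y = (c\<^sup>2 * \<mu>) *\<^sub>R x" for x y :: "'a chain"
  proof
    assume "inverse (c\<^sup>2) *\<^sub>R y = \<mu> *\<^sub>R x"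
    then have "c\<^sup>2 *\<^sub>R inverse (c\<^sup>2) *\<^sub>R y = c\<^sup>2 *\<^sub>R \<mu> *\<^sub>R x" by simp
    then show "y = (c\<^sup>2 * \<mu>) *\<^sub>R x" using c by simp
  qed (use c in simp)
  ultimately show ?thesis
    by (simp add: eigenspace_eq_hodge[OF ip] eigenspace_eq_hodge[OF ip'])
qed

text \<open>The sum is reindexed by \<nu> = c^2 \<mu>, and the power of \<nu> / c^2 releases the
  factor |c|^(2s).\<close>

lemma zeta_weight_scale:
  assumes G: "pair_digraph G" and g: "\<And>v. g v \<noteq> 0" and c: "c \<noteq> 0"
  shows "zeta G f (\<lambda>v. c * g v) n s = exp (2 * s * ln \<bar>c\<bar>) * zeta G f g n s"
proof -
  have c2: "c\<^sup>2 > 0" using c by simp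
  have "zeta G f (\<lambda>v. c * g v) n s =
      (\<Sum>\<mu> | \<mu> > 0 \<and> eigenspace G f g n (c\<^sup>2 * \<mu>) \<noteq> {0}.
        real (dim (eigenspace G f g n (c\<^sup>2 * \<mu>))) * \<mu> powr (- s))"
    by (simp add: zeta_def eigenspace_weight_scale[OF assms])
  also have "\<dots> = (\<Sum>\<nu> | \<nu> > 0 \<and> eigenspace G f g n \<nu> \<noteq> {0}.
        real (dim (eigenspace G f g n \<nu>)) * (\<nu> / c\<^sup>2) powr (- s))"
    by (rule sum.reindex_bij_witness[of _ "\<lambda>\<nu>. \<nu> / c\<^sup>2" "\<lambda>\<mu>. c\<^sup>2 * \<mu>"])
      (use c c2 in \<open>auto simp: zero_less_mult_iff\<close>)
  also have "\<dots> = (\<Sum>\<nu> | \<nu> > 0 \<and> eigenspace G f g n \<nu> \<noteq> {0}.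
        exp (2 * s * ln \<bar>c\<bar>) * (real (dim (eigenspace G f g n \<nu>)) * \<nu> powr (- s)))"
  proof (rule sum.cong[OF refl])
    fix \<nu> assume "\<nu> \<in> {\<nu>. \<nu> > 0 \<and> eigenspace G f g n \<nu> \<noteq> {0}}"
    then have \<nu>: "\<nu> > 0" by simp
    have "ln (c\<^sup>2) = 2 * ln \<bar>c\<bar>"
      using ln_realpow[of "\<bar>c\<bar>" 2] c by simp
    then have "(\<nu> / c\<^sup>2) powr (- s) = exp (2 * s * ln \<bar>c\<bar>) * \<nu> powr (- s)"
      using \<nu> c c2 by (simp add: powr_def ln_div algebra_simps flip: exp_add)
    then show "real (dim (eigenspace G f g n \<nu>)) * (\<nu> / c\<^sup>2) powr (- s) =
        exp (2 * s * ln \<bar>c\<bar>) * (real (dim (eigenspace G f g n \<nu>)) * \<nu> powr (- s))"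
      by simp
  qed
  finally show ?thesis by (simp add: zeta_def sum_distrib_left)
qed

text \<open>Product rule at 0, where the exponential factor has value 1 and derivative 2 ln
  |c|.\<close>

lemma deriv_zeta_weight_scale:
  assumes G: "pair_digraph G" and g: "\<And>v. g v \<noteq> 0" and c: "c \<noteq> 0"
  shows "deriv (zeta G f (\<lambda>v. c * g v) n) 0 = deriv (zeta G f g n) 0 + 2 * ln \<bar>c\<bar> * zeta G f g n 0"
proof -
  have "zeta G f g n differentiable (at 0)"
    by (rule zeta_differentiable[OF sum_dim_positive_eigenspaces(1)[OF G g]])
  then have "(zeta G f g n has_real_derivative deriv (zeta G f g n) 0) (at 0)"
    by (metis DERIV_imp_deriv real_differentiable_def)
  then have "((\<lambda>s. exp (2 * s * ln \<bar>c\<bar>) * zeta G f g n s) has_real_derivative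
      (deriv (zeta G f g n) 0 + 2 * ln \<bar>c\<bar> * zeta G f g n 0)) (at 0)"
    by (auto intro!: derivative_eq_intros)
  moreover have "zeta G f (\<lambda>v. c * g v) n = (\<lambda>s. exp (2 * s * ln \<bar>c\<bar>) * zeta G f g n s)"
    by (rule ext) (rule zeta_weight_scale[OF assms])
  ultimately show ?thesis by (simp add: DERIV_imp_deriv)
qed

section \<open>Invariance under rescaling of paths\<close>

text \<open>An isometry of one Omega onto the other that intertwines the boundaries also intertwines
  their adjoints: each test vector \<open>u\<close> is the image of some \<open>w\<close>.\<close>

lemma adj_vertex_scale:
  assumes G: "pair_digraph G" and g: "\<And>v. g v \<noteq> 0" and h: "\<And>v. h v \<noteq> 0"
  shows "inner_form.adj (path_ip g) (Omega G f n) (boundary f n) (vertex_scale h y) =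
    vertex_scale h (inner_form.adj (path_ip (\<lambda>v. g v * h v)) (Omega G (\<lambda>v. f v * h v) n)
      (boundary (\<lambda>v. f v * h v) n) y)"
proof (rule inner_form.adj_eqI)
  show "inner_form (path_ip g)" by (rule inner_form_path_ip) (rule g)
  show "subspace (Omega G f n)" by (rule subspace_Omega)
  have gh: "g v * h v \<noteq> 0" for v by (simp add: g h)
  note adj = adj_Omega[where g = "\<lambda>v. g v * h v" and f = "\<lambda>v. f v * h v" and n = n, OF G gh]
  show "vertex_scale h (inner_form.adj (path_ip (\<lambda>v. g v * h v)) (Omega G (\<lambda>v. f v * h v) n)
      (boundary (\<lambda>v. f v * h v) n) y) \<in> Omega G f n"
    using adj(1) by (simp add: vertex_scale_Omega_iff h)
  fix u assume "u \<in> Omega G f n"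
  then obtain w where w: "w \<in> Omega G (\<lambda>v. f v * h v) n" "u = vertex_scale h w"
    using vertex_scale_image_Omega[of h G f n] h by blast
  have "boundary f n u = vertex_scale h (boundary (\<lambda>v. f v * h v) n w)"
    using w vertex_scale_boundary[of w G n h f] by (simp add: Omega_def)
  then show "path_ip g u (vertex_scale h (inner_form.adj (path_ip (\<lambda>v. g v * h v))
      (Omega G (\<lambda>v. f v * h v) n) (boundary (\<lambda>v. f v * h v) n) y)) =
      path_ip g (boundary f n u) (vertex_scale h y)"
    using adj(2)[OF w(1)] by (simp add: w(2) flip: path_ip_vertex_scale)
qed

lemma eigenspace_vertex_scale:
  assumes G: "pair_digraph G" and g: "\<And>v. g v \<noteq> 0" and h: "\<And>v. h v \<noteq> 0"
  shows "vertex_scale h ` eigenspace G (\<lambda>v. f v * h v) (\<lambda>v. g v * h v) n \<mu> = eigenspace G f g n \<mu>"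
proof -
  let ?f = "\<lambda>v. f v * h v" and ?g = "\<lambda>v. g v * h v"
  note ip = inner_form_path_ip[of g, OF g]
  have ip': "inner_form (path_ip ?g)" by (rule inner_form_path_ip) (simp add: g h)
  have inj: "inj (vertex_scale h)" by (rule bij_is_inj[OF bij_vertex_scale[OF h]])
  have "chain_laplacian G f g n (vertex_scale h x) = vertex_scale h (chain_laplacian G ?f ?g n x)"
    if x: "x \<in> Omega G ?f n" for x
  proof -
    have 1: "boundary f n (vertex_scale h x) = vertex_scale h (boundary ?f n x)"
      using x vertex_scale_boundary[of x G n h f] by (simp add: Omega_def)
    have gh: "?g v \<noteq> 0" for v by (simp add: g h)
    have "inner_form.adj (path_ip ?g) (Omega G ?f (n + 1)) (boundary ?f (n + 1)) x \<in> Omega G ?f (n + 1)"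
      by (rule adj_Omega(1)[where g = ?g, OF G gh])
    then have "inner_form.adj (path_ip ?g) (Omega G ?f (n + 1)) (boundary ?f (n + 1)) x
        \<in> allowed_chains G (n + 1)"
      by (simp add: Omega_def)
    note 2 = vertex_scale_boundary[OF this, of h f]
    show ?thesis
      unfolding inner_form.hodge_laplacian_def[OF ip] inner_form.hodge_laplacian_def[OF ip']
        1 adj_vertex_scale[OF assms] 2[symmetric] linear_add[OF linear_vertex_scale] ..
  qed
  then have "vertex_scale h x \<in> eigenspace G f g n \<mu> \<longleftrightarrow> x \<in> eigenspace G ?f ?g n \<mu>" for x
    unfolding eigenspace_eq_hodge[OF ip] eigenspace_eq_hodge[OF ip']
    by (auto simp: vertex_scale_Omega_iff h inj_eq[OF inj] simp flip: linear_scale[OF linear_vertex_scale])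
  note iff = this
  show ?thesis
  proof (rule set_eqI)
    fix y
    obtain x where "y = vertex_scale h x"
      by (rule surjE[OF bij_is_surj[OF bij_vertex_scale[of h, OF h]]])
    then show "y \<in> vertex_scale h ` eigenspace G ?f ?g n \<mu> \<longleftrightarrow> y \<in> eigenspace G f g n \<mu>"
      by (simp only: inj_image_mem_iff[OF inj] iff)
  qed
qed

text \<open>Corresponding eigenspaces have equal dimension, and \<open>top_degree\<close> depends on
  \<open>G\<close> alone, so the defining sums agree term by term.\<close>

lemma torsion_vertex_scale:
  assumes G: "pair_digraph G" and g: "\<And>v. g v \<noteq> 0" and h: "\<And>v. h v \<noteq> 0"
  shows "torsion G (\<lambda>v. f v * h v) (\<lambda>v. g v * h v) = torsion G f g"
proof -
  have inj: "inj (vertex_scale h)" by (rule bij_is_inj[OF bij_vertex_scale[OF h]])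
  let ?E = "eigenspace G (\<lambda>v. f v * h v) (\<lambda>v. g v * h v)"
  have "dim (eigenspace G f g n \<mu>) = dim (?E n \<mu>)" for n \<mu>
    using dim_injective_image[OF linear_vertex_scale inj_on_subset[OF inj subset_UNIV], of "?E n \<mu>"]
    by (simp add: eigenspace_vertex_scale[OF assms])
  moreover have "eigenspace G f g n \<mu> = {0} \<longleftrightarrow> ?E n \<mu> = {0}" for n \<mu>
    using inj_image_eq_iff[OF inj, of "?E n \<mu>" "{0}"]
    by (simp add: eigenspace_vertex_scale[OF assms] linear_0[OF linear_vertex_scale])
  ultimately have "zeta G (\<lambda>v. f v * h v) (\<lambda>v. g v * h v) n = zeta G f g n" for n
    by (simp add: zeta_def fun_eq_iff)
  then show ?thesis by (simp add: torsion_def)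
qed

text \<open>The exponent is defined by the unweighted complex. Reading f as the product of 1 and f,
  \<open>vertex_scale f\<close> carries the weighted image onto the unweighted one.\<close>

lemma dim_boundary_Omega:
  assumes "\<And>v. f v \<noteq> 0"
  shows "dim (boundary f n ` Omega G f n) = dim (boundary (\<lambda>_. 1) n ` Omega G (\<lambda>_. 1) n)"
proof -
  have inj: "inj (vertex_scale f)" by (rule bij_is_inj[OF bij_vertex_scale[OF assms]])
  have "vertex_scale f ` boundary f n ` Omega G f n = boundary (\<lambda>_. 1) n ` vertex_scale f ` Omega G f n"
    unfolding image_image
    using vertex_scale_boundary[of _ G n f "\<lambda>_. 1"] by (intro image_cong) (auto simp: Omega_def)
  also have "\<dots> = boundary (\<lambda>_. 1) n ` Omega G (\<lambda>_. 1) n"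
    using vertex_scale_image_Omega[of f G "\<lambda>_. 1" n] assms by simp
  finally show ?thesis
    using dim_injective_image[OF linear_vertex_scale inj_on_subset[OF inj subset_UNIV]] by metis
qed

section \<open>Dependence on the weights through their values on vertices\<close>

lemma boundary_cong:
  assumes "\<forall>v\<in>pverts G. f v = f' v" "x \<in> allowed_chains G n"
  shows "boundary f n x = boundary f' n x"
proof (rule allowed_chains_linear_eqI[OF linear_boundary linear_boundary assms(2)])
  fix p assume "p \<in> allowed_paths G n"
  then have "f (p ! i) = f' (p ! i)" if "i \<le> n" for i
    using assms(1) that nth_mem[of i p] by (auto simp: allowed_paths_def simp del: nth_mem)
  then have "path_boundary f n p = path_boundary f' n p"
    by (simp add: path_boundary_def)
  then show "boundary f n (path_chain p) = boundary f' n (path_chain p)"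
    by (simp add: boundary_path_chain)
qed

lemma path_ip_cong:
  assumes "\<forall>v\<in>pverts G. g v = g' v" "x \<in> allowed_chains G n"
  shows "path_ip g x y = path_ip g' x y"
proof -
  have "map g p = map g' p" if "p \<in> Poly_Mapping.keys x" for p
    using keys_allowed_chains[OF assms(2)] that assms(1) by (auto simp: allowed_paths_def)
  then show ?thesis
    unfolding path_ip_superset[OF finite_keys subset_refl] by (intro sum.cong refl) (simp only:)
qed

text \<open>The theorem assumes nonvanishing on \<open>pverts G\<close>, while the lemmas above use
  weights that vanish nowhere on the type; this allows passing from one to the other.\<close>

lemma torsion_cong:
  assumes G: "pair_digraph G" and g': "\<And>v. g' v \<noteq> 0"
    and f: "\<forall>v\<in>pverts G. f v = f' v" and g: "\<forall>v\<in>pverts G. g v = g' v"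
  shows "torsion G f g = torsion G f' g'"
proof -
  have Omega: "Omega G f n = Omega G f' n" for n
    using boundary_cong[OF f] by (auto simp: Omega_def)
  have chain_inner: "chain_inner g x y = chain_inner g' x y"
    if "x \<in> allowed_chains G n" "y \<in> allowed_chains G n" for x y n
    using path_ip_cong[OF g] that by (simp add: chain_inner_eq_path_ip)
  have adjoint: "boundary_adjoint G f g n y = boundary_adjoint G f' g' n y"
    if "y \<in> allowed_chains G (n - 1)" for n y
  proof -
    have "x \<in> Omega G f n \<and> (\<forall>u\<in>Omega G f n. chain_inner g u x = chain_inner g (boundary f n u) y) \<longleftrightarrow>
      x \<in> Omega G f' n \<and> (\<forall>u\<in>Omega G f' n. chain_inner g' u x = chain_inner g' (boundary f' n u) y)" for x
      unfolding Omega
      using that boundary_cong[OF f] chain_inner[of _ n x] chain_inner[of _ "n - 1" y]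
      by (auto simp: Omega_def)
    then show ?thesis unfolding boundary_adjoint_def by simp
  qed
  have "Laplacian G f g n x = Laplacian G f' g' n x" if "x \<in> Omega G f' n" for n x
  proof -
    have x: "x \<in> allowed_chains G n" "boundary f' n x \<in> allowed_chains G (n - 1)"
      using that by (simp_all add: Omega_def)
    \<comment> \<open>Nonvanishing of \<open>g'\<close> makes the adjoint exist, so its
      \<open>THE\<close> term lies in Omega and \<open>boundary_cong\<close> applies to it.\<close>
    have "boundary_adjoint G f' g' (n + 1) x \<in> Omega G f' (n + 1)"
      using boundary_adjoint_eq_adj[OF inner_form_path_ip[of g', OF g'], of x G "n + 1" f'] x(1)
        adj_Omega(1)[where g = g' and f = f' and n = "n + 1" and y = x, OF G g'] by simp
    then have "boundary_adjoint G f' g' (n + 1) x \<in> allowed_chains G (n + 1)"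
      by (simp add: Omega_def)
    then show ?thesis
      using x adjoint[of x "n + 1"] adjoint[of "boundary f' n x" n] boundary_cong[OF f]
      by (simp add: Laplacian_def)
  qed
  then have "eigenspace G f g n \<mu> = eigenspace G f' g' n \<mu>" for n \<mu>
    by (auto simp: eigenspace_def Omega)
  then show ?thesis by (simp add: torsion_def zeta_def[abs_def])
qed

section \<open>The exponent and the torsion formulas\<close>

text \<open>For n between 1 and N, r(n) has coefficients (-1)^n n and (-1)^(n-1) (n-1), which add up
  to (-1)^n; r(N+1) meets only the second kind and is left over. On the left r(0) has coefficient 0,
  whence the hypothesis.\<close>

lemma alternating_rank_sum:
  fixes r :: "nat \<Rightarrow> int"
  assumes "r 0 = 0"
  shows "(\<Sum>n=0..N. (-1) ^ n * int n * (r n + r (n + 1))) =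
    (\<Sum>n=0..N. (-1) ^ n * r n) + (-1) ^ N * int N * r (N + 1)"
proof (induction N)
  case (Suc N)
  show ?case
    unfolding sum.atLeast0_atMost_Suc Suc.IH by (simp add: ring_distribs)
qed (simp add: assms)

lemma torsion_weight_scale:
  assumes G: "pair_digraph G" and vanish: "\<exists>N. \<forall>n\<ge>N + 1. Omega G (\<lambda>_. 1) n = {0}"
    and f: "\<And>v. f v \<noteq> 0" and g: "\<And>v. g v \<noteq> 0" and c: "c \<noteq> 0"
  shows "torsion G f (\<lambda>v. c * g v) = torsion_factor G c * torsion G f g"
proof -
  define r where "r n = dim (boundary (\<lambda>_. 1) n ` Omega G (\<lambda>_. 1) n)" for n
  define N where "N = top_degree G"
  \<comment> \<open>By \<open>vanish\<close> the least bound is attained. This later makes r(N+1),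
    the remainder of the telescoping, equal to 0.\<close>
  have N: "\<forall>n\<ge>N + 1. Omega G (\<lambda>_. 1) n = {0}"
    unfolding N_def top_degree_def by (rule LeastI_ex[OF vanish])
  have r_top: "r n = 0" if "n > N" for n
    using N that by (simp add: r_def linear_0[OF linear_boundary] dim_zero_subspace)
  have "boundary (\<lambda>_. 1) 0 ` Omega G (\<lambda>_. 1) 0 = {0}"
    using subspace_0[OF subspace_Omega, of G "\<lambda>_. 1" 0] by auto
  then have r_0: "r 0 = 0" by (simp add: r_def dim_zero_subspace)
  have zeta_0: "zeta G f g n 0 = real (r n + r (n + 1))" for n
    using zeta_0[OF G, of g f n, OF g] dim_boundary_Omega[of f, OF f] by (simp add: r_def)
  \<comment> \<open>\<open>Sum_any\<close> is a genuine sum only for finite support, so the support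
    is bounded by N first.\<close>
  have "n \<le> N" if "(-1) ^ n * int (r n) \<noteq> 0" for n
    using r_top[of n] that by (cases "n \<le> N") simp_all
  then have "{n. (-1) ^ n * int (r n) \<noteq> 0} \<subseteq> {0..N}" by auto
  then have exponent: "torsion_exponent G = (\<Sum>n=0..N. (-1) ^ n * int (r n))"
    unfolding torsion_exponent_def r_def[symmetric] by (intro Sum_any.expand_superset) auto
  have "(\<Sum>n=0..N. (-1) ^ n * int n * (int (r n) + int (r (n + 1)))) = torsion_exponent G"
    using alternating_rank_sum[of "\<lambda>n. int (r n)" N] r_0 r_top[of "N + 1"] exponent by simp
  then have "real_of_int (\<Sum>n=0..N. (-1) ^ n * int n * (int (r n) + int (r (n + 1)))) =
      real_of_int (torsion_exponent G)"
    by (simp only:)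
  then have sum: "(\<Sum>n=0..N. (-1) ^ n * real n * real (r n + r (n + 1))) = real_of_int (torsion_exponent G)"
    by simp
  have "(\<Sum>n=0..N. (-1) ^ n * real n * deriv (zeta G f (\<lambda>v. c * g v) n) 0) =
      (\<Sum>n=0..N. (-1) ^ n * real n * deriv (zeta G f g n) 0) +
      2 * ln \<bar>c\<bar> * (\<Sum>n=0..N. (-1) ^ n * real n * real (r n + r (n + 1)))"
    by (simp add: deriv_zeta_weight_scale[OF G g c] zeta_0 sum_distrib_left sum.distrib algebra_simps)
  then have "torsion G f (\<lambda>v. c * g v) = exp (ln \<bar>c\<bar> * real_of_int (torsion_exponent G)) * torsion G f g"
    unfolding torsion_def N_def[symmetric] sum by (simp add: algebra_simps flip: exp_add)
  also have "exp (ln \<bar>c\<bar> * real_of_int (torsion_exponent G)) = \<bar>c\<bar> powr real_of_int (torsion_exponent G)"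
    using c by (simp add: powr_def mult.commute)
  also have "\<dots> = torsion_factor G c"
    using c by (simp add: torsion_factor_def powr_real_of_int')
  finally show ?thesis .
qed

theorem theorem1p1:
  fixes G :: "'a pair_pre_digraph" and f g h :: "'a \<Rightarrow> real"
  assumes "pair_digraph G"
    and "\<exists>N>0. \<forall>n\<ge>N + 1. Omega G (\<lambda>_. 1) n = {0}"
    and "\<forall>v\<in>pverts G. f v \<noteq> 0"
    and "\<forall>v\<in>pverts G. g v \<noteq> 0"
    and "\<forall>v\<in>pverts G. h v \<noteq> 0"
  shows "torsion G (\<lambda>v. f v * h v) (\<lambda>v. g v * h v) = torsion G f g
    \<and> (\<forall>c::real. c \<noteq> 0 \<longrightarrow>
          torsion G f (\<lambda>v. c * g v) = torsion_factor G c * torsion G f g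
        \<and> torsion G (\<lambda>v. c * f v) g = inverse (torsion_factor G c) * torsion G f g)"
proof -
  \<comment> \<open>Only the values on \<open>pverts G\<close> matter, so the weights can be made nowhere zero.\<close>
  define ext where "ext k = (\<lambda>v. if v \<in> pverts G then k v else 1)" for k :: "'a \<Rightarrow> real"
  note G = assms(1)
  have nz: "ext f v \<noteq> 0" "ext g v \<noteq> 0" "ext h v \<noteq> 0" for v
    using assms(3-5) by (auto simp: ext_def)
  have eq: "torsion G f g = torsion G (ext f) (ext g)"
    by (rule torsion_cong[OF G]) (use nz in \<open>auto simp: ext_def\<close>)
  have vanish: "\<exists>N. \<forall>n\<ge>N + 1. Omega G (\<lambda>_. 1) n = {0}" using assms(2) by blast
  have "torsion G (\<lambda>v. f v * h v) (\<lambda>v. g v * h v) =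
      torsion G (\<lambda>v. ext f v * ext h v) (\<lambda>v. ext g v * ext h v)"
    by (rule torsion_cong[OF G]) (use nz in \<open>auto simp: ext_def\<close>)
  also have "\<dots> = torsion G (ext f) (ext g)"
    by (rule torsion_vertex_scale[OF G nz(2,3)])
  finally have "torsion G (\<lambda>v. f v * h v) (\<lambda>v. g v * h v) = torsion G f g"
    by (simp add: eq)
  moreover have "torsion G f (\<lambda>v. c * g v) = torsion_factor G c * torsion G f g"
    and "torsion G (\<lambda>v. c * f v) g = inverse (torsion_factor G c) * torsion G f g" if c: "c \<noteq> 0" for c
  proof -
    have "torsion G f (\<lambda>v. c * g v) = torsion G (ext f) (\<lambda>v. c * ext g v)"
      by (rule torsion_cong[OF G]) (use nz c in \<open>auto simp: ext_def\<close>)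
    then show "torsion G f (\<lambda>v. c * g v) = torsion_factor G c * torsion G f g"
      using torsion_weight_scale[OF G vanish nz(1,2) c] by (simp add: eq)
    \<comment> \<open>Writing g as c^(-1) g times c makes the constant c a common factor of both
      weights, which part (i) removes.\<close>
    have "torsion G (\<lambda>v. c * f v) g =
        torsion G (\<lambda>v. ext f v * c) (\<lambda>v. inverse c * ext g v * c)"
      by (rule torsion_cong[OF G]) (use nz c in \<open>auto simp: ext_def\<close>)
    also have "\<dots> = torsion G (ext f) (\<lambda>v. inverse c * ext g v)"
      by (rule torsion_vertex_scale[OF G]) (use nz c in auto)
    also have "\<dots> = torsion_factor G (inverse c) * torsion G f g"
      using torsion_weight_scale[OF G vanish nz(1,2), of "inverse c"] c by (simp add: eq)
    finally show "torsion G (\<lambda>v. c * f v) g = inverse (torsion_factor G c) * torsion G f g"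
      by (simp add: torsion_factor_def abs_inverse power_int_inverse)
  qed
  ultimately show ?thesis by blast
qed

end
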